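(* Let $f\in\mathcal C^1(E)$ be $L$-Lipschitz smooth, let $g:E\to\overline{\mathbb R}$ be proper, lsc and prox-bounded with threshold $\gamma_g$, let $F=f+g$ with $F_\star=\inf F>-\infty$, and let the reference function $\phi$ satisfy the standing assumptions listed in the context, with $D=\sup_{x\in\operatorname{dom}\phi}\|x\|<\infty$. Assume that the stochastic gradient oracle satisfies $\mathbb E_\xi[\nabla f(x,\xi)]=\nabla f(x)$ and $\mathbb E_\xi[\|\nabla f(x,\xi)-\nabla f(x)\|^p]\le\sigma^p$ for all $x\in E$, for some $\sigma\ge 0$ and $p\in(1,2]$. Let $\bar\gamma>0$ and $x^0\in\operatorname{dom}g$. For $K\in\mathbb N$ put $\alpha=(K+1)^{-1/2}$ and $\gamma=\bar\gamma(K+1)^{-3/4}$, and assume $\gamma_g>\gamma/\mu$. Let $\{x^k\}_{k\in\mathbb N_0}$ be generated by $$y^k=x^k-\gamma\nabla\phi^*(d^k),\qquad x^{k+1}\in\operatorname*{arg\,min}_{x\in E}\; g(x)+(\gamma\star\phi)(x-y^k),$$ with $d^0=\nabla f(x^0,\xi^0)$ and $d^k=\alpha\nabla f(x^k,\xi^k)+(1-\alpha)d^{k-1}$ for $k\ge1$. Then $$\frac1{K+1}\sum_{k=0}^K\mathbb E[\operatorname{gap}(x^{k+1})]\le O\left((K+1)^{-\min\left\{\frac14,\frac{p-1}{2p}\right\}}\right),$$ where the constant hidden in $O(\cdot)$ does not depend on $K$.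
   Context: $E$ is a Euclidean space with inner product $\langle\cdot,\cdot\rangle$ and induced norm $\|\cdot\|$; $\overline{\mathbb R}=\mathbb R\cup\{\pm\infty\}$. Standing assumptions on the reference function $\phi:E\to\overline{\mathbb R}$: $\phi$ is lsc, $\mu$-strongly convex ($\mu>0$) and even, $\phi\ge0$, $\phi(0)=0$; $\operatorname{int}\operatorname{dom}\phi\ne\emptyset$; $\phi\in\mathcal C^1(\operatorname{int}\operatorname{dom}\phi)$; and $\|\nabla\phi(x^k)\|\to+\infty$ for any sequence $\{x^k\}$ in $\operatorname{int}\operatorname{dom}\phi$ converging to a boundary point of $\operatorname{dom}\phi$. $\phi^*(y)=\sup_{x\in E}\langle y,x\rangle-\phi(x)$ is the convex conjugate (finite and differentiable on $E$). For $\gamma>0$, $(\gamma\star\phi)(x)=\gamma\phi(\gamma^{-1}x)$. The Bregman divergence is $D_{\phi^*}(y,\bar y)=\phi^*(y)-\phi^*(\bar y)-\langle\nabla\phi^*(\bar y),y-\bar y\rangle$. $f$ is $L$-Lipschitz smooth ($L>0$) if $\|\nabla f(x)-\nabla f(\bar x)\|\le L\|x-\bar x\|$ for all $x,\bar x\in E$. A function $g:E\to\overline{\mathbb R}$ is prox-bounded if there is $\lambda>0$ with $\inf_{x\in E}g(x)+\frac1{2\lambda}\|x-\bar x\|^2>-\infty$ for some $\bar x\in E$; the supremum of all such $\lambda$ is the threshold $\gamma_g$. $\partial g$ is the limiting (Mordukhovich) subdifferential. Subgradient chosen by the algorithm: $\widetilde\nabla g(x^{k+1})\in\partial g(x^{k+1})$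 is the subgradient given by the optimality condition of the backward step, i.e. $\widetilde\nabla g(x^{k+1})=-\nabla\phi(\frac1{\gamma}(x^{k+1}-y^k))$, equivalently $x^{k+1}-x^k=-\gamma\nabla\phi^*(d^k)-\gamma\nabla\phi^*(\widetilde\nabla g(x^{k+1}))$. The stationarity measure is $\operatorname{gap}(x^{k+1})=D_{\phi^*}(\nabla f(x^{k+1}),-\widetilde\nabla g(x^{k+1}))$. The samples $\xi^0,\xi^1,\dots$ are independent copies of the random variable $\xi$, $\xi^k$ being drawn at iteration $k$ independently of the past. $\mathbb E$ denotes total expectation. *)

theory Defs
  imports "HOL-Probability.Probability"
begin

section \<open>Extended-real-valued functions\<close>

definition edom :: "('a \<Rightarrow> ereal) \<Rightarrow> 'a set" where
  "edom h = {x. h x < \<infinity>}"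

definition proper_fun :: "('a \<Rightarrow> ereal) \<Rightarrow> bool" where
  "proper_fun h \<longleftrightarrow> edom h \<noteq> {} \<and> (\<forall>x. h x > -\<infinity>)"

definition lsc_fun :: "('a::topological_space \<Rightarrow> ereal) \<Rightarrow> bool" where
  "lsc_fun h \<longleftrightarrow> (\<forall>x. h x \<le> Liminf (at x) h)"

text \<open>
  Strong convexity of \<open>h\<close> is convexity of \<open>h - \<mu>/2 \<parallel>\<cdot>\<parallel>\<^sup>2\<close>. For a function that never takes the
  value \<open>-\<infinity>\<close> (reference functions are nonnegative), this is ordinary convexity of a real function
  on the effective domain; the library's \<^const>\<open>convex_on\<close> includes convexity of that domain.
\<close>
definition strongly_convex_fun :: "real \<Rightarrow> ('a::real_inner \<Rightarrow> ereal) \<Rightarrow> bool" where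
  "strongly_convex_fun \<mu> h \<longleftrightarrow>
     convex_on (edom h) (\<lambda>x. real_of_ereal (h x) - \<mu> / 2 * (norm x)\<^sup>2)"

definition prox_bounded_with :: "('a::real_normed_vector \<Rightarrow> ereal) \<Rightarrow> real \<Rightarrow> bool" where
  "prox_bounded_with h l \<longleftrightarrow>
     l > 0 \<and> (\<exists>xb. (INF x. h x + ereal (1 / (2 * l) * (norm (x - xb))\<^sup>2)) > -\<infinity>)"

definition prox_bounded :: "('a::real_normed_vector \<Rightarrow> ereal) \<Rightarrow> bool" where
  "prox_bounded h \<longleftrightarrow> (\<exists>l. prox_bounded_with h l)"

definition prox_threshold :: "('a::real_normed_vector \<Rightarrow> ereal) \<Rightarrow> ereal" where
  "prox_threshold h = (SUP l\<in>{l. prox_bounded_with h l}. ereal l)"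

definition frechet_subdifferential ::
    "('a::euclidean_space \<Rightarrow> ereal) \<Rightarrow> 'a \<Rightarrow> 'a set" where
  "frechet_subdifferential h x =
     {v. \<bar>h x\<bar> \<noteq> \<infinity> \<and>
         Liminf (at x) (\<lambda>y. (h y - h x - ereal (v \<bullet> (y - x))) / ereal (norm (y - x))) \<ge> 0}"

definition limiting_subdifferential ::
    "('a::euclidean_space \<Rightarrow> ereal) \<Rightarrow> 'a \<Rightarrow> 'a set" where
  "limiting_subdifferential h x =
     {v. \<bar>h x\<bar> \<noteq> \<infinity> \<and>
         (\<exists>xs vs. xs \<longlonglongrightarrow> x \<and> (\<lambda>n. h (xs n)) \<longlonglongrightarrow> h x \<and>
            (\<forall>n. vs n \<in> frechet_subdifferential h (xs n)) \<and> vs \<longlonglongrightarrow> v)}"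

definition conjugate :: "('a::real_inner \<Rightarrow> ereal) \<Rightarrow> 'a \<Rightarrow> ereal" where
  "conjugate h y = (SUP x. ereal (y \<bullet> x) - h x)"

definition epi_scale :: "real \<Rightarrow> ('a::real_vector \<Rightarrow> ereal) \<Rightarrow> 'a \<Rightarrow> ereal" where
  "epi_scale \<gamma> h x = ereal \<gamma> * h (x /\<^sub>R \<gamma>)"


section \<open>Gradients\<close>

definition grad :: "('a::real_inner \<Rightarrow> real) \<Rightarrow> 'a \<Rightarrow> 'a" where
  "grad h x = (THE v. GDERIV h x :> v)"

definition C1_on :: "'a::real_inner set \<Rightarrow> ('a \<Rightarrow> real) \<Rightarrow> bool" where
  "C1_on S h \<longleftrightarrow> (\<forall>x\<in>S. GDERIV h x :> grad h x) \<and> continuous_on S (grad h)"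

text \<open>
  Gradient of an extended-real-valued function; meaningful in the interior of the set where the
  function is finite.
\<close>
definition egrad :: "('a::real_inner \<Rightarrow> ereal) \<Rightarrow> 'a \<Rightarrow> 'a" where
  "egrad h = grad (\<lambda>x. real_of_ereal (h x))"

definition bregman :: "('a::real_inner \<Rightarrow> ereal) \<Rightarrow> 'a \<Rightarrow> 'a \<Rightarrow> real" where
  "bregman h y yb = real_of_ereal (h y) - real_of_ereal (h yb) - egrad h yb \<bullet> (y - yb)"


section \<open>Reference function, oracle and algorithm\<close>

definition reference_function :: "real \<Rightarrow> ('a::euclidean_space \<Rightarrow> ereal) \<Rightarrow> bool" where
  "reference_function \<mu> \<phi> \<longleftrightarrow>
     lsc_fun \<phi> \<and> \<mu> > 0 \<and> strongly_convex_fun \<mu> \<phi> \<and>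
     (\<forall>x. \<phi> (- x) = \<phi> x) \<and> (\<forall>x. \<phi> x \<ge> 0) \<and> \<phi> 0 = 0 \<and>
     interior (edom \<phi>) \<noteq> {} \<and>
     C1_on (interior (edom \<phi>)) (\<lambda>x. real_of_ereal (\<phi> x)) \<and>
     (\<forall>xs z. (\<forall>k. xs k \<in> interior (edom \<phi>)) \<longrightarrow> xs \<longlonglongrightarrow> z \<longrightarrow> z \<in> frontier (edom \<phi>) \<longrightarrow>
        filterlim (\<lambda>k. norm (egrad \<phi> (xs k))) at_top sequentially)"

text \<open>
  \<open>P\<close> is the law of the random variable \<open>\<xi>\<close> and \<open>G x s\<close> stands for \<open>\<nabla>f(x, s)\<close>. Joint measurability
  and integrability are spelled out because the library's integral of a non-integrable function is
  \<open>0\<close>.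
\<close>
definition stochastic_oracle ::
    "('a::euclidean_space \<Rightarrow> real) \<Rightarrow> 's measure \<Rightarrow> ('a \<Rightarrow> 's \<Rightarrow> 'a) \<Rightarrow> real \<Rightarrow> real \<Rightarrow> bool" where
  "stochastic_oracle f P G \<sigma> p \<longleftrightarrow>
     prob_space P \<and>
     (\<lambda>(x, s). G x s) \<in> borel \<Otimes>\<^sub>M P \<rightarrow>\<^sub>M borel \<and>
     (\<forall>x. integrable P (G x) \<and> (\<integral>s. G x s \<partial>P) = grad f x) \<and>
     (\<forall>x. integrable P (\<lambda>s. norm (G x s - grad f x) powr p) \<and>
          (\<integral>s. norm (G x s - grad f x) powr p \<partial>P) \<le> \<sigma> powr p)"

text \<open>
  The sigma-algebra generated by everything known before the \<open>k\<close>-th sample is drawn, namely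
  \<open>\<xi>\<^sup>0, \<dots>, \<xi>\<^sup>k\<^sup>-\<^sup>1\<close> and \<open>x\<^sup>0, \<dots>, x\<^sup>k\<close>. The iterates have to be included: the minimizers in the
  backward step need not be unique, so \<open>x\<^sup>k\<close> need not be a function of the earlier samples.
\<close>
definition past ::
    "'w measure \<Rightarrow> 's measure \<Rightarrow> (nat \<Rightarrow> 'w \<Rightarrow> 's) \<Rightarrow> (nat \<Rightarrow> 'w \<Rightarrow> 'a::euclidean_space) \<Rightarrow>
       nat \<Rightarrow> 'w measure" where
  "past M P \<xi> x k =
     vimage_algebra (space M) (\<lambda>w. (\<lambda>i\<in>{..<k}. \<xi> i w, \<lambda>i\<in>{..k}. x i w))
       (PiM {..<k} (\<lambda>_. P) \<Otimes>\<^sub>M PiM {..k} (\<lambda>_. borel))"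

definition fresh_samples ::
    "'w measure \<Rightarrow> 's measure \<Rightarrow> (nat \<Rightarrow> 'w \<Rightarrow> 's) \<Rightarrow> (nat \<Rightarrow> 'w \<Rightarrow> 'a::euclidean_space) \<Rightarrow> bool" where
  "fresh_samples M P \<xi> x \<longleftrightarrow>
     prob_space.indep_vars M (\<lambda>_. P) \<xi> UNIV \<and>
     (\<forall>k. distr M P (\<xi> k) = P) \<and>
     (\<forall>k. prob_space.indep_set M (sets (past M P \<xi> x k))
                                 (sets (vimage_algebra (space M) (\<xi> k) P)))"

text \<open>
  \<open>v\<close> is the subgradient of \<open>g\<close> at the new iterate \<open>x'\<close> given by the optimality condition of the
  backward step from \<open>y\<close>. The interior condition says that \<open>\<nabla>\<phi>\<close> exists at the point in question;
  for nonconvex \<open>g\<close> it does not follow from minimality.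
\<close>
definition backward_subgradient ::
    "('a::euclidean_space \<Rightarrow> ereal) \<Rightarrow> ('a \<Rightarrow> ereal) \<Rightarrow> real \<Rightarrow> 'a \<Rightarrow> 'a \<Rightarrow> 'a \<Rightarrow> bool" where
  "backward_subgradient g \<phi> \<gamma> y x' v \<longleftrightarrow>
     v \<in> limiting_subdifferential g x' \<and>
     (x' - y) /\<^sub>R \<gamma> \<in> interior (edom \<phi>) \<and>
     v = - egrad \<phi> ((x' - y) /\<^sub>R \<gamma>)"

text \<open>\<open>v k\<close> is the subgradient selected at the iterate \<open>x (Suc k)\<close>.\<close>
definition algorithm_run ::
    "('a::euclidean_space \<Rightarrow> ereal) \<Rightarrow> ('a \<Rightarrow> ereal) \<Rightarrow> 's measure \<Rightarrow> ('a \<Rightarrow> 's \<Rightarrow> 'a) \<Rightarrow>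
       real \<Rightarrow> real \<Rightarrow> 'a \<Rightarrow> 'w measure \<Rightarrow> (nat \<Rightarrow> 'w \<Rightarrow> 's) \<Rightarrow>
       (nat \<Rightarrow> 'w \<Rightarrow> 'a) \<Rightarrow> (nat \<Rightarrow> 'w \<Rightarrow> 'a) \<Rightarrow> (nat \<Rightarrow> 'w \<Rightarrow> 'a) \<Rightarrow> (nat \<Rightarrow> 'w \<Rightarrow> 'a) \<Rightarrow> bool"
where
  "algorithm_run g \<phi> P G \<alpha> \<gamma> x0 M \<xi> x y d v \<longleftrightarrow>
     prob_space M \<and>
     (\<forall>k. x k \<in> borel_measurable M) \<and>
     fresh_samples M P \<xi> x \<and>
     (\<forall>w\<in>space M.
        x 0 w = x0 \<and>
        d 0 w = G x0 (\<xi> 0 w) \<and>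
        (\<forall>k\<ge>1. d k w = \<alpha> *\<^sub>R G (x k w) (\<xi> k w) + (1 - \<alpha>) *\<^sub>R d (k - 1) w) \<and>
        (\<forall>k. y k w = x k w - \<gamma> *\<^sub>R egrad (conjugate \<phi>) (d k w)) \<and>
        (\<forall>k. is_arg_min (\<lambda>z. g z + epi_scale \<gamma> \<phi> (z - y k w)) (\<lambda>_. True) (x (Suc k) w)) \<and>
        (\<forall>k. backward_subgradient g \<phi> \<gamma> (y k w) (x (Suc k) w) (v k w)))"

definition gap ::
    "('a::euclidean_space \<Rightarrow> real) \<Rightarrow> ('a \<Rightarrow> ereal) \<Rightarrow> 'a \<Rightarrow> 'a \<Rightarrow> real" where
  "gap f \<phi> x v = bregman (conjugate \<phi>) (grad f x) (- v)"

end

theory Submission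
  imports Defs
begin

text \<open>
  Let \<open>D\<close> bound the domain of \<open>\<phi>\<close>, and let \<open>F = f + g\<close>. By duality the gap is the Fenchel--Young gap
  \<open>\<phi>\<^sup>*(\<nabla>f(x')) + \<phi>(u) - \<nabla>f(x') \<bullet> u\<close> at the scaled backward step \<open>u = (x' - y)/\<gamma>\<close>. Testing the minimality of
  the new iterate \<open>x'\<close> against the old iterate \<open>x\<close> and using smoothness of \<open>f\<close> gives the one-step inequality
  \<open>\<gamma> gap \<le> F(x) - F(x') + 2D\<gamma> \<parallel>d - \<nabla>f(x)\<parallel> + 8LD\<^sup>2\<gamma>\<^sup>2\<close> (\<open>forward_backward_step\<close>). Boundedness
  of the domain is essential here: it makes steps at most \<open>2D\<gamma>\<close> long and the conjugate \<open>D\<close>-Lipschitz, so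
  that the gradient error enters only linearly and only its first moment has to be controlled.

  The gradient error splits into two parts. One is a martingale, the averaged noise of the samples after
  the first. Its \<open>p\<close>-th moment is of order \<open>\<alpha> powr (p - 1)\<close> (\<open>averaged_noise_moment\<close>), by an expansion of
  \<open>\<parallel>a + b\<parallel>\<^sup>p\<close> whose linear term vanishes in the mean because each sample is independent of the past
  (\<open>norm_add_powr_le\<close>, \<open>fresh_noise_orthogonal\<close>). Its first moment is therefore of order
  \<open>\<alpha> powr ((p - 1)/p)\<close>. The other part is controlled on every path (\<open>tracking_error_pathwise\<close>): the
  geometrically forgotten noise of the first sample, and the lag of the average behind the moving
  gradient, at most \<open>2LD\<gamma>/\<alpha>\<close>.

  Summing over the run telescopes the values of \<open>F\<close> (\<open>expected_gap_sum\<close>). With \<open>N = K + 1\<close>, the average gap is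
  of order \<open>1/(\<gamma> N) + \<alpha> powr ((p - 1)/p) + 1/(\<alpha> N) + \<gamma>/\<alpha> + \<gamma>\<close>, and the choices of \<open>\<alpha>\<close> and \<open>\<gamma>\<close> turn this into
  the stated rate (\<open>rate_arithmetic\<close>).
\<close>

section \<open>Lower semicontinuous functions\<close>

lemma lsc_fun_open_superlevel:
  assumes "lsc_fun h"
  shows "open {x. c < h x}"
proof (subst open_subopen, intro ballI)
  fix x assume "x \<in> {x. c < h x}"
  then have cx: "c < h x" by simp
  have "h x \<le> Liminf (at x) h" using assms by (auto simp: lsc_fun_def)
  then have "\<forall>\<^sub>F y in at x. c < h y"
    using cx by (intro less_LiminfD) auto
  then have "\<forall>\<^sub>F y in nhds x. c < h y"
    using cx by (simp add: eventually_nhds_conv_at)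
  then show "\<exists>T. open T \<and> x \<in> T \<and> T \<subseteq> {x. c < h x}"
    unfolding eventually_nhds by blast
qed

lemma lsc_fun_borel_measurable:
  assumes "lsc_fun h"
  shows "h \<in> borel_measurable borel"
  using lsc_fun_open_superlevel[OF assms] by (intro borel_measurableI_greater) auto

text \<open>
  A lower semicontinuous function attains its minimum on a compact set, also after subtracting a
  linear function. If no point were minimal, every value \<open>q c\<close> would be beaten somewhere, so the open
  sets \<open>U c\<close> of points whose value exceeds \<open>q c\<close> would cover the ball containing the domain. In a
  finite subcover, the centre with the least value lies in no set of the subcover.
\<close>
lemma lsc_fun_attains_tilted_min:
  fixes h :: "'a::euclidean_space \<Rightarrow> ereal"
  assumes lsc: "lsc_fun h" and nonneg: "\<And>x. 0 \<le> h x"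
    and ne: "edom h \<noteq> {}" and bdd: "\<And>x. x \<in> edom h \<Longrightarrow> norm x \<le> D"
  obtains u where "u \<in> edom h"
    and "\<And>x. x \<in> edom h \<Longrightarrow> y \<bullet> x - real_of_ereal (h x) \<le> y \<bullet> u - real_of_ereal (h u)"
proof -
  define q where "q x = real_of_ereal (h x) - y \<bullet> x" for x
  have fin: "h x = ereal (real_of_ereal (h x))" if "x \<in> edom h" for x
    using that nonneg[of x] by (cases "h x") (auto simp: edom_def)
  have "\<exists>u\<in>edom h. \<forall>x\<in>edom h. q u \<le> q x"
  proof (rule ccontr)
    assume "\<not> ?thesis"
    then have no: "\<And>u. u \<in> edom h \<Longrightarrow> \<exists>x\<in>edom h. q x < q u" by force
    define U where "U c = {x. ereal (q c + y \<bullet> x) < h x}" for c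
    have op: "open (U c)" for c
    proof (subst open_subopen, intro ballI)
      fix x assume "x \<in> U c"
      then have "ereal (q c + y \<bullet> x) < h x" by (simp add: U_def)
      then obtain r where r: "ereal (q c + y \<bullet> x) < ereal r" "ereal r < h x"
        using ereal_dense2 by blast
      have "open ({z. q c + y \<bullet> z < r} \<inter> {z. ereal r < h z})"
        by (intro open_Int lsc_fun_open_superlevel lsc open_Collect_less continuous_intros)
      moreover have "({z. q c + y \<bullet> z < r} \<inter> {z. ereal r < h z}) \<subseteq> U c"
        by (auto simp: U_def intro: less_trans[of _ "ereal r"])
      ultimately show "\<exists>T. open T \<and> x \<in> T \<and> T \<subseteq> U c"
        using r by (intro exI[of _ "{z. q c + y \<bullet> z < r} \<inter> {z. ereal r < h z}"]) auto
    qed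
    have cov: "cball 0 D \<subseteq> (\<Union>c\<in>edom h. U c)"
    proof
      fix x
      show "x \<in> (\<Union>c\<in>edom h. U c)"
      proof (cases "x \<in> edom h")
        case True
        then obtain c where c: "c \<in> edom h" "q c < q x" using no by blast
        have "ereal (q c + y \<bullet> x) < ereal (real_of_ereal (h x))" using c(2) by (simp add: q_def)
        then have "x \<in> U c" unfolding U_def mem_Collect_eq by (subst fin[OF True])
        then show ?thesis using c by blast
      next
        case False
        then have "h x = \<infinity>" by (simp add: edom_def less_top[symmetric])
        then show ?thesis using ne by (auto simp: U_def)
      qed
    qed
    obtain C where C: "C \<subseteq> edom h" "finite C" "cball 0 D \<subseteq> (\<Union>c\<in>C. U c)"
      using compactE_image[OF compact_cball, of "edom h" U 0 D] op cov by metis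
    have Cne: "C \<noteq> {}" using C ne bdd by (auto simp: subset_iff)
    define c0 where "c0 = arg_min_on q C"
    have c0: "c0 \<in> C" "\<And>c. c \<in> C \<Longrightarrow> q c0 \<le> q c"
      using arg_min_if_finite[OF C(2) Cne, of q] by (auto simp: c0_def not_less)
    have c0d: "c0 \<in> edom h" using c0 C by auto
    then obtain c where c: "c \<in> C" "c0 \<in> U c"
      using C(3) bdd by (auto simp: subset_iff)
    then have "q c + y \<bullet> c0 < real_of_ereal (h c0)"
      using fin[OF c0d] by (auto simp: U_def) (metis ereal_less(2) less_ereal.simps(1))
    then have "q c < q c0" by (simp add: q_def)
    with c0(2)[OF c(1)] show False by simp
  qed
  then show ?thesis using that by (force simp: q_def)
qed

section \<open>The conjugate of a reference function with bounded domain\<close>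

lemma grad_eqI:
  assumes "GDERIV h x :> v"
  shows "grad h x = v"
  unfolding grad_def
proof (rule the_equality)
  fix w assume "GDERIV h x :> w"
  with assms have "(\<lambda>z. z \<bullet> w) = (\<lambda>z. z \<bullet> v)"
    unfolding gderiv_def by (rule has_derivative_unique[rotated])
  then show "w = v" by (metis vector_eq_ldot)
qed (rule assms)

text \<open>
  The relation \<open>y \<in> \<partial>h(u)\<close> of convex analysis, written as optimality of \<open>u\<close> in the supremum that
  defines the conjugate at \<open>y\<close>. The whole section rests on reading it in both directions.
\<close>
definition convex_subgradient :: "('a::euclidean_space \<Rightarrow> ereal) \<Rightarrow> 'a \<Rightarrow> 'a \<Rightarrow> bool" where
  "convex_subgradient h u y \<longleftrightarrow> u \<in> edom h \<and>
     (\<forall>x\<in>edom h. y \<bullet> x - real_of_ereal (h x) \<le> y \<bullet> u - real_of_ereal (h u))"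

locale bounded_reference =
  fixes \<phi> :: "'a::euclidean_space \<Rightarrow> ereal" and \<mu> D :: real
  assumes ref: "reference_function \<mu> \<phi>"
    and bounded_dom: "x \<in> edom \<phi> \<Longrightarrow> norm x \<le> D"
begin

abbreviation phi_r where "phi_r x \<equiv> real_of_ereal (\<phi> x)"
abbreviation conj_r where "conj_r y \<equiv> real_of_ereal (conjugate \<phi> y)"

text \<open>
  The mirror map sends \<open>y\<close> to the maximizer of \<open>y \<bullet> x - \<phi> x\<close> over \<open>x\<close>.
\<close>
abbreviation mirror where "mirror \<equiv> egrad (conjugate \<phi>)"

lemma mu_pos: "\<mu> > 0"
  and phi_nonneg: "\<phi> x \<ge> 0"
  and phi_zero: "\<phi> 0 = 0"
  and phi_lsc: "lsc_fun \<phi>"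
  and phi_strongly_convex: "convex_on (edom \<phi>) (\<lambda>x. phi_r x - \<mu> / 2 * (norm x)\<^sup>2)"
  and phi_gderiv: "u \<in> interior (edom \<phi>) \<Longrightarrow> GDERIV phi_r u :> egrad \<phi> u"
  using ref by (auto simp: reference_function_def strongly_convex_fun_def C1_on_def egrad_def)

lemma zero_in_dom: "0 \<in> edom \<phi>"
  by (simp add: edom_def phi_zero)

lemma D_nonneg: "0 \<le> D"
  using bounded_dom[OF zero_in_dom] by simp

lemma phi_finite: "x \<in> edom \<phi> \<Longrightarrow> \<phi> x = ereal (phi_r x)"
  using phi_nonneg[of x] by (cases "\<phi> x") (auto simp: edom_def)

lemma phi_infinite: "x \<notin> edom \<phi> \<Longrightarrow> \<phi> x = \<infinity>"
  by (simp add: edom_def less_top[symmetric])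

lemma ex_maximizer: "\<exists>u. convex_subgradient \<phi> u y"
  using lsc_fun_attains_tilted_min[OF phi_lsc phi_nonneg _ bounded_dom, of y] zero_in_dom
  unfolding convex_subgradient_def by (metis empty_iff)

lemma conjugate_eq:
  assumes "convex_subgradient \<phi> u y"
  shows "conjugate \<phi> y = ereal (y \<bullet> u - phi_r u)"
  unfolding conjugate_def
proof (rule antisym)
  have u: "u \<in> edom \<phi>" using assms by (simp add: convex_subgradient_def)
  show "(SUP x. ereal (y \<bullet> x) - \<phi> x) \<le> ereal (y \<bullet> u - phi_r u)"
  proof (rule SUP_least)
    fix x
    show "ereal (y \<bullet> x) - \<phi> x \<le> ereal (y \<bullet> u - phi_r u)"
    proof (cases "x \<in> edom \<phi>")
      case True
      then have "ereal (y \<bullet> x) - \<phi> x = ereal (y \<bullet> x - phi_r x)"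
        using phi_finite[OF True] by (metis ereal_minus(1))
      then show ?thesis using assms True by (simp add: convex_subgradient_def)
    qed (simp add: phi_infinite)
  qed
  have "ereal (y \<bullet> u - phi_r u) = ereal (y \<bullet> u) - \<phi> u"
    using phi_finite[OF u] by (metis ereal_minus(1))
  also have "\<dots> \<le> (SUP x. ereal (y \<bullet> x) - \<phi> x)" by (rule SUP_upper) simp
  finally show "ereal (y \<bullet> u - phi_r u) \<le> (SUP x. ereal (y \<bullet> x) - \<phi> x)" .
qed

lemma fenchel_young:
  assumes "x \<in> edom \<phi>"
  shows "y \<bullet> x - phi_r x \<le> conj_r y"
  using ex_maximizer[of y] assms conjugate_eq by (fastforce simp: convex_subgradient_def)

text \<open>
  Strong convexity makes \<open>\<phi>\<close> grow quadratically above its tangent at \<open>u\<close>. Comparing only with the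
  midpoint of \<open>u\<close> and \<open>x\<close> avoids a limit and costs a factor \<open>2\<close> against the optimal constant
  \<open>\<mu>/2\<close>; it serves to make the maximizer Lipschitz in \<open>y\<close>, for which any positive constant will do.
\<close>
lemma subgradient_growth:
  assumes u: "convex_subgradient \<phi> u y" and x: "x \<in> edom \<phi>"
  shows "phi_r u + y \<bullet> (x - u) + \<mu> / 4 * (norm (x - u))\<^sup>2 \<le> phi_r x"
proof -
  have ud: "u \<in> edom \<phi>" using u by (simp add: convex_subgradient_def)
  define m where "m = (1/2) *\<^sub>R u + (1/2) *\<^sub>R x"
  have md: "m \<in> edom \<phi>"
    using phi_strongly_convex ud x unfolding convex_on_def m_def by (auto intro!: convexD)
  have "phi_r m - \<mu> / 2 * (norm m)\<^sup>2
      \<le> (1 - 1/2) * (phi_r u - \<mu> / 2 * (norm u)\<^sup>2) + 1/2 * (phi_r x - \<mu> / 2 * (norm x)\<^sup>2)"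
    using convex_onD[OF phi_strongly_convex, of "1/2" u x] ud x by (simp add: m_def)
  moreover have "y \<bullet> m - phi_r m \<le> y \<bullet> u - phi_r u"
    using u md by (simp add: convex_subgradient_def)
  moreover have "y \<bullet> m = (y \<bullet> u + y \<bullet> x) / 2" by (simp add: m_def inner_add_right)
  moreover have "(norm m)\<^sup>2 = ((norm u)\<^sup>2 + (norm x)\<^sup>2) / 2 - (norm (x - u))\<^sup>2 / 4"
    by (simp add: m_def power2_norm_eq_inner algebra_simps inner_commute)
      (simp add: add_divide_distrib diff_divide_distrib)
  then have "\<mu> / 2 * (norm m)\<^sup>2 = \<mu> / 2 * (((norm u)\<^sup>2 + (norm x)\<^sup>2) / 2 - (norm (x - u))\<^sup>2 / 4)"
    by simp
  ultimately show ?thesis by (simp add: inner_diff_right field_simps)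
qed

lemma maximizer_lipschitz:
  assumes u: "convex_subgradient \<phi> u y" and u': "convex_subgradient \<phi> u' y'"
  shows "norm (u' - u) \<le> 2 / \<mu> * norm (y' - y)"
proof -
  have d: "u \<in> edom \<phi>" "u' \<in> edom \<phi>" using u u' by (auto simp: convex_subgradient_def)
  have "\<mu> / 2 * (norm (u' - u))\<^sup>2 \<le> (y' - y) \<bullet> (u' - u)"
    using subgradient_growth[OF u d(2)] subgradient_growth[OF u' d(1)]
    by (simp add: inner_diff_left inner_diff_right norm_minus_commute)
  also have "\<dots> \<le> norm (y' - y) * norm (u' - u)" by (rule norm_cauchy_schwarz)
  finally have *: "\<mu> / 2 * norm (u' - u) * norm (u' - u) \<le> norm (y' - y) * norm (u' - u)"
    by (simp add: power2_eq_square)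
  show ?thesis
  proof (cases "u' = u")
    case False
    then have "\<mu> / 2 * norm (u' - u) \<le> norm (y' - y)"
      by (intro mult_right_le_imp_le[OF *]) simp
    then have "norm (u' - u) * \<mu> \<le> 2 * norm (y' - y)" by (simp add: mult.commute)
    then show ?thesis using mu_pos by (simp add: pos_le_divide_eq)
  qed (use mu_pos in simp)
qed

text \<open>
  Danskin's argument: \<open>u\<close> is a competitor in the supremum at \<open>y'\<close> and \<open>u'\<close> in the one at \<open>y\<close>. This traps
  the first-order error of the conjugate between \<open>0\<close> and \<open>(y' - y) \<bullet> (u' - u)\<close>, which is quadratic in
  \<open>y' - y\<close> because maximizers depend on \<open>y\<close> in a Lipschitz way.
\<close>
lemma conjugate_gderiv:
  assumes u: "convex_subgradient \<phi> u y"
  shows "GDERIV (\<lambda>y. conj_r y) y :> u"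
  unfolding gderiv_def
proof (rule has_derivativeI_sandwich[of 1])
  show "bounded_linear (\<lambda>h. h \<bullet> u)" by (rule bounded_linear_inner_left)
  show "((\<lambda>y'. 2 / \<mu> * norm (y' - y)) \<longlongrightarrow> 0) (at y)"
    using mu_pos by (auto intro!: tendsto_eq_intros)
  fix y' assume "y' \<noteq> y"
  obtain u' where u': "convex_subgradient \<phi> u' y'" using ex_maximizer by blast
  have d: "u \<in> edom \<phi>" "u' \<in> edom \<phi>" using u u' by (auto simp: convex_subgradient_def)
  have "conj_r y = y \<bullet> u - phi_r u" "conj_r y' = y' \<bullet> u' - phi_r u'"
    using conjugate_eq u u' by auto
  moreover have "y \<bullet> u' - phi_r u' \<le> y \<bullet> u - phi_r u" "y' \<bullet> u - phi_r u \<le> y' \<bullet> u' - phi_r u'"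
    using u u' d by (auto simp: convex_subgradient_def)
  ultimately have "0 \<le> conj_r y' - conj_r y - (y' - y) \<bullet> u"
    "conj_r y' - conj_r y - (y' - y) \<bullet> u \<le> (y' - y) \<bullet> (u' - u)"
    by (auto simp: inner_diff_left inner_diff_right)
  moreover have "(y' - y) \<bullet> (u' - u) \<le> norm (y' - y) * (2 / \<mu> * norm (y' - y))"
    using norm_cauchy_schwarz[of "y' - y" "u' - u"] maximizer_lipschitz[OF u u']
    by (smt (verit) mult_left_mono norm_ge_zero)
  ultimately have "norm (conj_r y' - conj_r y - (y' - y) \<bullet> u) \<le> 2 / \<mu> * norm (y' - y) * norm (y' - y)"
    by (simp add: mult.commute)
  then show "norm (conj_r y' - conj_r y - (y' - y) \<bullet> u) / norm (y' - y) \<le> 2 / \<mu> * norm (y' - y)"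
    using \<open>y' \<noteq> y\<close> by (simp add: pos_divide_le_eq)
qed auto

lemma mirror_eq:
  assumes "convex_subgradient \<phi> u y"
  shows "mirror y = u"
  unfolding egrad_def by (rule grad_eqI[OF conjugate_gderiv[OF assms]])

lemma mirror_subgradient: "convex_subgradient \<phi> (mirror y) y"
  using ex_maximizer mirror_eq by metis

lemma mirror_in_dom: "mirror y \<in> edom \<phi>"
  using mirror_subgradient by (simp add: convex_subgradient_def)

lemma continuous_mirror: "continuous_on UNIV mirror"
proof -
  have "(2 / \<mu>)-lipschitz_on UNIV mirror"
    using maximizer_lipschitz[OF mirror_subgradient mirror_subgradient] mu_pos
    by (intro lipschitz_onI) (auto simp: dist_norm)
  then show ?thesis by (rule lipschitz_on_continuous_on)
qed

text \<open>
  The slopes of the conjugate are points of the domain of \<open>\<phi>\<close>, so its Lipschitz constant is the radius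
  \<open>D\<close> of that domain. This is where boundedness of the domain turns an error in the gradient into a
  proportional error in the gap.
\<close>
lemma conjugate_lipschitz: "conj_r y' \<le> conj_r y + D * norm (y' - y)"
proof -
  let ?u = "mirror y'"
  have "conj_r y' = y \<bullet> ?u - phi_r ?u + (y' - y) \<bullet> ?u"
    using conjugate_eq[OF mirror_subgradient, of y'] by (simp add: inner_diff_left)
  moreover have "(y' - y) \<bullet> ?u \<le> norm (y' - y) * D"
    using norm_cauchy_schwarz[of "y' - y" ?u] bounded_dom[OF mirror_in_dom, of y']
    by (smt (verit) mult_left_mono norm_ge_zero)
  ultimately show ?thesis
    using fenchel_young[OF mirror_in_dom, of y y'] by (simp add: mult.commute)
qed

lemma continuous_conjugate: "continuous_on UNIV (\<lambda>y. conj_r y)"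
proof -
  have "D-lipschitz_on UNIV (\<lambda>y. conj_r y)"
    using conjugate_lipschitz D_nonneg
    by (intro lipschitz_onI)
      (auto simp: dist_norm abs_le_iff, smt (verit), smt (verit) norm_minus_commute)
  then show ?thesis by (rule lipschitz_on_continuous_on)
qed

text \<open>
  A convex function lies above its tangent at an interior point of its domain; proved along the segment
  to \<open>x\<close>. It identifies the point \<open>u\<close> selected by a backward step with the mirror image of \<open>\<nabla>\<phi>(u)\<close>.
\<close>
lemma gradient_is_subgradient:
  assumes u: "u \<in> interior (edom \<phi>)"
  shows "convex_subgradient \<phi> u (egrad \<phi> u)"
proof -
  have ud: "u \<in> edom \<phi>" using u interior_subset by blast
  have sq: "convex_on (edom \<phi>) (\<lambda>x. \<mu> / 2 * (norm x)\<^sup>2)"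
  proof (rule convex_onI)
    show "convex (edom \<phi>)" using phi_strongly_convex by (rule convex_on_imp_convex)
    fix t :: real and a b :: 'a assume t: "0 < t" "t < 1"
    have "(norm ((1 - t) *\<^sub>R a + t *\<^sub>R b))\<^sup>2
        = (1 - t) * (norm a)\<^sup>2 + t * (norm b)\<^sup>2 - t * (1 - t) * (norm (a - b))\<^sup>2"
      by (simp add: power2_norm_eq_inner algebra_simps inner_commute)
    moreover have "0 \<le> t * (1 - t) * (norm (a - b))\<^sup>2" using t by simp
    ultimately have "(norm ((1 - t) *\<^sub>R a + t *\<^sub>R b))\<^sup>2 \<le> (1 - t) * (norm a)\<^sup>2 + t * (norm b)\<^sup>2"
      by linarith
    from mult_left_mono[OF this, of "\<mu> / 2"] mu_pos
    show "\<mu> / 2 * (norm ((1 - t) *\<^sub>R a + t *\<^sub>R b))\<^sup>2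
        \<le> (1 - t) * (\<mu> / 2 * (norm a)\<^sup>2) + t * (\<mu> / 2 * (norm b)\<^sup>2)"
      by (simp add: distrib_left mult.left_commute)
  qed
  have cv: "convex_on (edom \<phi>) phi_r"
    using convex_on_add[OF phi_strongly_convex sq] by simp
  have "egrad \<phi> u \<bullet> (x - u) \<le> phi_r x - phi_r u" if x: "x \<in> edom \<phi>" for x
  proof -
    define l where "l t = u + t *\<^sub>R (x - u)" for t :: real
    define A where "A = l -` edom \<phi>"
    have l_comb: "l ((1 - s) * a + s * b) = (1 - s) *\<^sub>R l a + s *\<^sub>R l b" for s a b
      by (simp add: l_def algebra_simps)
    have cA: "convex A"
      using convex_on_imp_convex[OF cv] unfolding A_def convex_alt by (simp add: l_comb)
    have cl: "convex_on A (\<lambda>t. phi_r (l t))"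
      using cA convex_onD[OF cv] by (intro convex_onI) (auto simp: l_comb A_def)
    have op: "open (l -` interior (edom \<phi>))"
      unfolding l_def by (intro open_vimage continuous_intros) auto
    have A0: "0 \<in> interior A"
      using op u interior_subset[of "edom \<phi>"]
      by (intro interiorI[of "l -` interior (edom \<phi>)"]) (auto simp: A_def l_def)
    have "(phi_r has_derivative (\<lambda>h. h \<bullet> egrad \<phi> u)) (at (l 0))"
      using phi_gderiv[OF u] by (simp add: gderiv_def l_def)
    moreover have "(l has_derivative (\<lambda>t. t *\<^sub>R (x - u))) (at 0)"
      unfolding l_def by (auto intro!: derivative_eq_intros)
    ultimately have "((\<lambda>t. phi_r (l t)) has_derivative (\<lambda>t. (t *\<^sub>R (x - u)) \<bullet> egrad \<phi> u)) (at 0)"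
      using diff_chain_at[of l _ 0 phi_r] by (fastforce simp: o_def)
    then have "((\<lambda>t. phi_r (l t)) has_field_derivative ((x - u) \<bullet> egrad \<phi> u)) (at 0)"
      by (rule has_derivative_imp_has_field_derivative) simp
    then have "((\<lambda>t. phi_r (l t)) has_field_derivative ((x - u) \<bullet> egrad \<phi> u)) (at 0 within A)"
      by (rule has_field_derivative_at_within)
    from convex_on_imp_above_tangent[OF cl _ A0 _ this, of 1] cA x
    show ?thesis by (simp add: A_def l_def convex_connected inner_commute)
  qed
  then show ?thesis
    unfolding convex_subgradient_def using ud by (force simp: inner_diff_right)
qed

text \<open>
  The Bregman divergence of the conjugate is a Fenchel--Young gap. In this form the subgradient is gone:
  the gap is nonnegative by \<open>fenchel_young\<close>, and it is visibly a measurable function of \<open>x\<close> and \<open>u\<close>.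
\<close>
lemma gap_eq:
  assumes u: "u \<in> interior (edom \<phi>)"
  shows "gap f \<phi> x (- egrad \<phi> u) = conj_r (grad f x) + phi_r u - grad f x \<bullet> u"
  using conjugate_eq[OF gradient_is_subgradient[OF u]] mirror_eq[OF gradient_is_subgradient[OF u]]
  by (simp add: gap_def bregman_def inner_diff_right inner_commute)

end

section \<open>Descent along one forward-backward step\<close>

text \<open>
  The gradient is taken at the new point \<open>x'\<close>, because that is where the gap is measured. The mean value
  theorem gives \<open>L\<close> in place of the sharp \<open>L/2\<close>, which affects constants only.
\<close>
lemma smooth_descent:
  fixes f :: "'a::euclidean_space \<Rightarrow> real"
  assumes f: "C1_on UNIV f" and L: "L-lipschitz_on UNIV (grad f)"
  shows "f x' \<le> f x + grad f x' \<bullet> (x' - x) + L * (norm (x' - x))\<^sup>2"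
proof -
  define l where "l t = x + t *\<^sub>R (x' - x)" for t :: real
  have fd: "((\<lambda>t. f (l t)) has_derivative (\<lambda>h. h *\<^sub>R (x' - x) \<bullet> grad f (l t))) (at t within {0..1})" for t
  proof -
    have "(f has_derivative (\<lambda>h. h \<bullet> grad f (l t))) (at (l t) within l ` {0..1})"
      using f by (simp add: C1_on_def gderiv_def has_derivative_at_withinI)
    moreover have "(l has_derivative (\<lambda>h. h *\<^sub>R (x' - x))) (at t within {0..1})"
      unfolding l_def by (auto intro!: derivative_eq_intros)
    ultimately show ?thesis
      by (rule diff_chain_within[rotated, unfolded o_def])
  qed
  from mvt_simple[OF zero_less_one fd]
  obtain t where t: "t \<in> {0<..<1}" "f x' - f x = (x' - x) \<bullet> grad f (l t)"
    by (auto simp: l_def)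
  have "x' - l t = (1 - t) *\<^sub>R (x' - x)" by (simp add: l_def algebra_simps)
  then have nt: "norm (l t - x') \<le> norm (x' - x)"
    using t by (simp add: norm_minus_commute[of "l t"] mult_left_le_one_le)
  have "(x' - x) \<bullet> (grad f (l t) - grad f x') \<le> norm (x' - x) * norm (grad f (l t) - grad f x')"
    by (rule norm_cauchy_schwarz)
  also have "\<dots> \<le> norm (x' - x) * (L * norm (l t - x'))"
    using lipschitz_onD[OF L, of "l t" x'] by (intro mult_left_mono) (auto simp: dist_norm)
  also have "\<dots> \<le> norm (x' - x) * (L * norm (x' - x))"
    using nt lipschitz_on_nonneg[OF L] by (intro mult_left_mono) auto
  finally show ?thesis
    using t(2) by (simp add: inner_diff_right inner_commute power2_eq_square algebra_simps)
qed

context bounded_reference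
begin

text \<open>
  Put \<open>a = \<nabla>\<phi>\<^sup>*(d)\<close> and \<open>u = (x' - y)/\<gamma>\<close>, so that \<open>x' - x = \<gamma>(u - a)\<close> with both points in the domain of
  \<open>\<phi>\<close>; hence steps are at most \<open>2D\<gamma>\<close> long whatever \<open>d\<close> is. Comparing the minimizer \<open>x'\<close> with the
  candidate \<open>x\<close> bounds the change of \<open>g\<close> by \<open>\<gamma>(\<phi>(a) - \<phi>(u))\<close>, and adding the estimate for \<open>f\<close> gives
  \<open>F(x') \<le> F(x) - \<gamma> gap + \<gamma>(\<phi>(a) + \<phi>\<^sup>*(\<nabla>f(x')) - \<nabla>f(x') \<bullet> a) + 4LD\<^sup>2\<gamma>\<^sup>2\<close>.
  The bracket is the Fenchel--Young gap of \<open>a\<close> against \<open>\<nabla>f(x')\<close>. It vanishes against \<open>d\<close>, so the Lipschitz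
  bound on the conjugate limits it to \<open>2D \<parallel>d - \<nabla>f(x')\<parallel>\<close>.
\<close>
lemma forward_backward_step:
  fixes g :: "'a \<Rightarrow> ereal"
  assumes f: "C1_on UNIV f" and L: "L-lipschitz_on UNIV (grad f)"
    and g: "proper_fun g" and \<gamma>: "\<gamma> > 0"
    and y: "y = x - \<gamma> *\<^sub>R mirror d"
    and mini: "is_arg_min (\<lambda>z. g z + epi_scale \<gamma> \<phi> (z - y)) (\<lambda>_. True) x'"
    and bs: "backward_subgradient g \<phi> \<gamma> y x' v"
    and x: "x \<in> edom g"
  shows backward_step_in_dom: "x' \<in> edom g"
    and step_length: "norm (x' - x) \<le> 2 * D * \<gamma>"
    and gap_nonneg: "0 \<le> gap f \<phi> x' v"
    and gap_descent: "\<gamma> * gap f \<phi> x' v \<le> (f x + real_of_ereal (g x)) - (f x' + real_of_ereal (g x'))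
           + 2 * D * \<gamma> * norm (d - grad f x) + 8 * L * D\<^sup>2 * \<gamma>\<^sup>2"
    and gap_as_fenchel_young: "gap f \<phi> x' v
        = conj_r (grad f x') + phi_r ((x' - y) /\<^sub>R \<gamma>) - grad f x' \<bullet> ((x' - y) /\<^sub>R \<gamma>)"
proof -
  define u a where "u = (x' - y) /\<^sub>R \<gamma>" and "a = mirror d"
  have u: "u \<in> interior (edom \<phi>)" and v: "v = - egrad \<phi> u"
    using bs by (auto simp: backward_subgradient_def u_def)
  have ud: "u \<in> edom \<phi>" using u interior_subset by blast
  have ad: "a \<in> edom \<phi>" by (simp add: a_def mirror_in_dom)
  have xa: "(x - y) /\<^sub>R \<gamma> = a" using \<gamma> by (simp add: y a_def)
  have step: "x' - x = \<gamma> *\<^sub>R (u - a)" using \<gamma> by (simp add: u_def a_def y algebra_simps)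
  have ua: "norm (u - a) \<le> 2 * D"
    using norm_triangle_ineq4[of u a] bounded_dom[OF ud] bounded_dom[OF ad] by linarith
  show len: "norm (x' - x) \<le> 2 * D * \<gamma>"
    using ua \<gamma> by (simp add: step mult.commute mult_le_cancel_left_pos)
  show gap: "gap f \<phi> x' v
        = conj_r (grad f x') + phi_r ((x' - y) /\<^sub>R \<gamma>) - grad f x' \<bullet> ((x' - y) /\<^sub>R \<gamma>)"
    unfolding v gap_eq[OF u] by (simp add: u_def)
  show "0 \<le> gap f \<phi> x' v"
    using fenchel_young[OF ud, of "grad f x'"] by (simp add: gap u_def)
  have "g x' + epi_scale \<gamma> \<phi> (x' - y) \<le> g x + epi_scale \<gamma> \<phi> (x - y)"
    using mini by (auto simp: is_arg_min_def not_less)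
  then have min_le: "g x' + ereal (\<gamma> * phi_r u) \<le> g x + ereal (\<gamma> * phi_r a)"
    unfolding epi_scale_def xa u_def[symmetric]
    using phi_finite[OF ud] phi_finite[OF ad] by (metis times_ereal.simps(1))
  have fin: "g z = ereal (real_of_ereal (g z))" if "z \<in> edom g" for z
    using that g by (cases "g z") (auto simp: edom_def proper_fun_def)
  show x': "x' \<in> edom g"
    using min_le x fin[OF x] by (cases "g x'") (auto simp: edom_def)
  have g_le: "real_of_ereal (g x') + \<gamma> * phi_r u \<le> real_of_ereal (g x) + \<gamma> * phi_r a"
    using min_le fin[OF x] fin[OF x'] by (metis ereal_less_eq(3) plus_ereal.simps(1))
  have L0: "0 \<le> L" by (rule lipschitz_on_nonneg[OF L])
  have sq: "(norm (x' - x))\<^sup>2 \<le> 4 * D\<^sup>2 * \<gamma>\<^sup>2"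
    using power_mono[OF len, of 2] by (simp add: power_mult_distrib)
  have f_le: "f x' \<le> f x + \<gamma> * (grad f x' \<bullet> (u - a)) + L * (4 * D\<^sup>2 * \<gamma>\<^sup>2)"
    using smooth_descent[OF f L, of x' x] mult_left_mono[OF sq L0] by (simp add: step)
  have ra: "phi_r a = d \<bullet> a - conj_r d"
    using conjugate_eq[OF mirror_subgradient, of d] by (simp add: a_def)
  have "phi_r a - grad f x' \<bullet> a + conj_r (grad f x') = conj_r (grad f x') - conj_r d + (d - grad f x') \<bullet> a"
    by (simp add: ra inner_diff_left)
  also have "\<dots> \<le> D * norm (grad f x' - d) + norm (d - grad f x') * D"
    using conjugate_lipschitz[of "grad f x'" d] norm_cauchy_schwarz[of "d - grad f x'" a]
      mult_left_mono[OF bounded_dom[OF ad], of "norm (d - grad f x')"] by simp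
  also have "\<dots> = 2 * D * norm (d - grad f x')" by (simp add: norm_minus_commute)
  also have "\<dots> \<le> 2 * D * (norm (d - grad f x) + L * (2 * D * \<gamma>))"
  proof (rule mult_left_mono)
    have "norm (d - grad f x') \<le> norm (d - grad f x) + norm (grad f x' - grad f x)"
      using norm_triangle_ineq4[of "d - grad f x" "grad f x' - grad f x"] by simp
    also have "norm (grad f x' - grad f x) \<le> L * norm (x' - x)"
      using lipschitz_onD[OF L, of x' x] by (simp add: dist_norm)
    also have "\<dots> \<le> L * (2 * D * \<gamma>)" using len L0 by (rule mult_left_mono)
    finally show "norm (d - grad f x') \<le> norm (d - grad f x) + L * (2 * D * \<gamma>)" by simp
  qed (simp add: D_nonneg)
  finally have *: "\<gamma> * (phi_r a - grad f x' \<bullet> a + conj_r (grad f x'))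
      \<le> \<gamma> * (2 * D * (norm (d - grad f x) + L * (2 * D * \<gamma>)))"
    using \<gamma> by (intro mult_left_mono) auto
  show "\<gamma> * gap f \<phi> x' v \<le> (f x + real_of_ereal (g x)) - (f x' + real_of_ereal (g x'))
           + 2 * D * \<gamma> * norm (d - grad f x) + 8 * L * D\<^sup>2 * \<gamma>\<^sup>2"
    using f_le g_le * unfolding gap u_def[symmetric]
    by (simp add: algebra_simps power2_eq_square inner_diff_right)
qed

end

section \<open>An inequality for p-th powers of norms\<close>

text \<open>
  Bernoulli's inequality for a real exponent in \<open>[0,1]\<close>: concavity of \<open>z powr q\<close> at \<open>z = 1\<close>.
\<close>
lemma powr_le_tangent:
  fixes z q :: real
  assumes "0 \<le> q" "q \<le> 1" "0 \<le> z"
  shows "z powr q \<le> 1 + q * (z - 1)"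
proof (cases "z = 0")
  case False
  then have "z powr q = exp ((1 - q) *\<^sub>R 0 + q *\<^sub>R ln z)"
    using assms by (simp add: powr_def)
  also have "\<dots> \<le> (1 - q) * exp 0 + q * exp (ln z)"
    using assms by (intro convex_onD[OF exp_convex]) auto
  finally show ?thesis using False assms by (simp add: algebra_simps)
qed (use assms in auto)

text \<open>
  The substitute for \<open>\<parallel>a + b\<parallel>\<^sup>2 = \<parallel>a\<parallel>\<^sup>2 + 2 a \<bullet> b + \<parallel>b\<parallel>\<^sup>2\<close> when only \<open>p\<close>-th moments exist: a term linear in
  \<open>b\<close>, which has mean zero when \<open>b\<close> is fresh noise, plus a multiple of \<open>\<parallel>b\<parallel>\<^sup>p\<close>. It yields
  moment bounds of von Bahr--Esseen type for martingales.

  If \<open>b\<close> is the longer vector, all terms are of order \<open>\<parallel>b\<parallel>\<^sup>p\<close>, and \<open>6\<close> collects \<open>2\<^sup>p \<le> 4\<close> from the left-hand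
  side and \<open>p \<le> 2\<close> from the linear term. Otherwise the tangent of \<open>z powr (p/2)\<close> at \<open>\<parallel>a\<parallel>\<^sup>2\<close> applies, and
  \<open>\<parallel>a\<parallel> powr (p - 2) \<le> \<parallel>b\<parallel> powr (p - 2)\<close> handles its quadratic remainder. For \<open>a = 0\<close> the linear term is
  \<open>0\<close> because \<open>a \<bullet> b\<close> is.
\<close>
lemma norm_add_powr_le:
  fixes a b :: "'a::real_inner"
  assumes p: "1 < p" "p \<le> 2"
  shows "norm (a + b) powr p \<le> norm a powr p + p * norm a powr (p - 2) * (a \<bullet> b) + 6 * norm b powr p"
proof (cases "norm a < norm b")
  case True
  have "norm (a + b) powr p \<le> (2 * norm b) powr p"
    using norm_triangle_ineq[of a b] True p by (intro powr_mono2) auto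
  also have "\<dots> \<le> 4 * norm b powr p"
  proof -
    have "(2::real) powr p \<le> 2 powr 2" using p by (intro powr_mono) auto
    then show ?thesis by (simp add: powr_mult mult_right_mono)
  qed
  finally have 1: "norm (a + b) powr p \<le> 4 * norm b powr p" .
  have 2: "norm a powr (p - 2) * - (a \<bullet> b) \<le> norm b powr p"
  proof (cases "a = 0")
    case False
    have "norm a powr (p - 2) * - (a \<bullet> b) \<le> norm a powr (p - 2) * (norm a * norm b)"
      using norm_cauchy_schwarz[of "- a" b] by (intro mult_left_mono) auto
    also have "\<dots> = norm a powr (p - 1) * norm b"
      using False powr_add[of "norm a" "p - 2" 1] by simp
    also have "\<dots> \<le> norm b powr (p - 1) * norm b"
      using True p by (intro mult_right_mono powr_mono2) auto
    also have "\<dots> = norm b powr p"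
      using True powr_add[of "norm b" "p - 1" 1] norm_ge_zero[of a] by simp
    finally show ?thesis .
  qed auto
  have "p * (norm a powr (p - 2) * - (a \<bullet> b)) \<le> p * norm b powr p"
    using 2 p by (intro mult_left_mono) auto
  also have "\<dots> \<le> 2 * norm b powr p" using p by (intro mult_right_mono) auto
  finally have "- (p * norm a powr (p - 2) * (a \<bullet> b)) \<le> 2 * norm b powr p" by (simp add: mult.assoc)
  moreover have "0 \<le> norm a powr p" by simp
  ultimately show ?thesis using 1 by linarith
next
  case False
  show ?thesis
  proof (cases "a = 0")
    case False
    define A t where "A = (norm a)\<^sup>2" and "t = 2 * (a \<bullet> b) + (norm b)\<^sup>2"
    have A: "A > 0" using False by (simp add: A_def)
    have sq: "(norm (a + b))\<^sup>2 = A + t"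
      by (simp add: A_def t_def power2_norm_eq_inner algebra_simps inner_commute)
    have half: "norm z powr p = ((norm z)\<^sup>2) powr (p / 2)" for z :: 'a
    proof (cases "z = 0")
      case False
      then have "(norm z)\<^sup>2 = norm z powr 2" by simp
      then show ?thesis by (simp only: powr_powr) simp
    qed auto
    have "(A + t) powr (p / 2) = A powr (p / 2) * (1 + t / A) powr (p / 2)"
    proof -
      have "0 \<le> 1 + t / A" using A sq zero_le_power2[of "norm (a + b)"] by (simp add: field_simps)
      moreover have "A + t = A * (1 + t / A)" using A by (simp add: distrib_left)
      ultimately show ?thesis using A by (metis powr_mult less_imp_le)
    qed
    also have "\<dots> \<le> A powr (p / 2) * (1 + p / 2 * (t / A))"
    proof (rule mult_left_mono)
      have "0 \<le> 1 + t / A" using A sq zero_le_power2[of "norm (a + b)"] by (simp add: field_simps)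
      then show "(1 + t / A) powr (p / 2) \<le> 1 + p / 2 * (t / A)"
        using powr_le_tangent[of "p / 2" "1 + t / A"] p by simp
    qed simp
    also have "A powr (p / 2) * (1 + p / 2 * (t / A)) = A powr (p/2) + p / 2 * (A powr (p/2) / A) * t"
      by (simp add: algebra_simps)
    also have "A powr (p / 2) / A = norm a powr (p - 2)"
      using False powr_diff[of "norm a" p 2] by (simp add: A_def flip: half)
    also have "p / 2 * norm a powr (p - 2) * t
        = p * norm a powr (p - 2) * (a \<bullet> b) + p / 2 * (norm a powr (p - 2) * (norm b)\<^sup>2)"
      by (simp add: t_def algebra_simps)
    finally have 1: "norm (a + b) powr p \<le> norm a powr p + p * norm a powr (p - 2) * (a \<bullet> b)
        + p / 2 * (norm a powr (p - 2) * (norm b)\<^sup>2)"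
      by (simp add: half[of "a + b"] half[of a] sq A_def)
    have "norm a powr (p - 2) * (norm b)\<^sup>2 \<le> norm b powr p"
    proof (cases "b = 0")
      case b: False
      have "norm a powr (p - 2) \<le> norm b powr (p - 2)"
        using \<open>\<not> norm a < norm b\<close> b p by (intro powr_mono2') auto
      then have "norm a powr (p - 2) * (norm b)\<^sup>2 \<le> norm b powr (p - 2) * (norm b)\<^sup>2"
        by (rule mult_right_mono) simp
      also have "\<dots> = norm b powr p"
        using b powr_add[of "norm b" "p - 2" 2] by simp
      finally show ?thesis .
    qed auto
    then have "p / 2 * (norm a powr (p - 2) * (norm b)\<^sup>2) \<le> 6 * norm b powr p"
      using p by (intro mult_mono) auto
    with 1 show ?thesis by linarith
  qed auto
qed

text \<open>
  A pointwise substitute for Jensen's inequality. Integrated, it bounds a first moment by a \<open>p\<close>-th moment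
  and gives integrability at the same time; \<open>c\<close> is to be chosen of the size of the \<open>L\<^sup>p\<close> norm.
\<close>
lemma le_const_add_powr:
  fixes t c p :: real
  assumes "1 < p" "0 \<le> t" "0 < c"
  shows "t \<le> c + c powr (1 - p) * t powr p"
proof (cases "t \<le> c")
  case False
  have "t = t powr (1 - p) * t powr p"
    using False assms by (simp flip: powr_add)
  also have "\<dots> \<le> c powr (1 - p) * t powr p"
    using False assms by (intro mult_right_mono powr_mono2') auto
  finally show ?thesis using assms by linarith
qed (simp add: add_increasing2)

section \<open>Noise of fresh samples\<close>

text \<open>
  A variable determined by \<open>F\<close> and a sample independent of \<open>F\<close> have a product law, so that Fubini applies
  to functions of the pair. The two may take values in different types, hence the direct check on
  rectangles.
\<close>
lemma (in prob_space) distr_pair_of_indep: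
  assumes indep: "indep_set (sets F) (sets (vimage_algebra (space M) Y P))"
    and F: "space F = space M" and Z: "Z \<in> F \<rightarrow>\<^sub>M N" and Y: "Y \<in> M \<rightarrow>\<^sub>M P"
  shows "Z \<in> M \<rightarrow>\<^sub>M N"
    and "distr M (N \<Otimes>\<^sub>M P) (\<lambda>w. (Z w, Y w)) = distr M N Z \<Otimes>\<^sub>M distr M P Y"
proof -
  have ev: "sets F \<subseteq> events" using indep by (rule indep_setD_ev1)
  show Z': "Z \<in> M \<rightarrow>\<^sub>M N"
    using Z ev F by (auto simp: measurable_def)
  interpret Z: prob_space "distr M N Z" by (rule prob_space_distr[OF Z'])
  interpret Y: prob_space "distr M P Y" by (rule prob_space_distr[OF Y])
  have "distr M N Z \<Otimes>\<^sub>M distr M P Y = distr M (N \<Otimes>\<^sub>M P) (\<lambda>w. (Z w, Y w))"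
  proof (rule pair_measure_eqI)
    fix A B assume "A \<in> sets (distr M N Z)" "B \<in> sets (distr M P Y)"
    then have A: "A \<in> sets N" and B: "B \<in> sets P" by auto
    have "Z -` A \<inter> space M \<in> sets F" using measurable_sets[OF Z A] F by simp
    moreover have "Y -` B \<inter> space M \<in> sets (vimage_algebra (space M) Y P)"
      by (rule in_vimage_algebra[OF B])
    ultimately have "prob ((Z -` A \<inter> space M) \<inter> (Y -` B \<inter> space M))
        = prob (Z -` A \<inter> space M) * prob (Y -` B \<inter> space M)"
      by (rule indep_setD[OF indep])
    moreover have "(\<lambda>w. (Z w, Y w)) -` (A \<times> B) \<inter> space M = (Z -` A \<inter> space M) \<inter> (Y -` B \<inter> space M)"
      by auto
    ultimately show "emeasure (distr M N Z) A * emeasure (distr M P Y) B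
        = emeasure (distr M (N \<Otimes>\<^sub>M P) (\<lambda>w. (Z w, Y w))) (A \<times> B)"
      using A B Z' Y by (simp add: emeasure_distr emeasure_eq_measure ennreal_mult')
  qed (simp_all add: Z.sigma_finite_measure_axioms Y.sigma_finite_measure_axioms cong: sets_pair_measure_cong)
  then show "distr M (N \<Otimes>\<^sub>M P) (\<lambda>w. (Z w, Y w)) = distr M N Z \<Otimes>\<^sub>M distr M P Y" ..
qed

locale gradient_oracle =
  fixes f :: "'a::euclidean_space \<Rightarrow> real" and P :: "'s measure" and G and \<sigma> p :: real
  assumes f: "C1_on UNIV f" and unbiased: "stochastic_oracle f P G \<sigma> p"
    and p: "1 < p" "p \<le> 2"
begin

definition noise where "noise x s = G x s - grad f x"

lemma grad_borel [measurable]: "grad f \<in> borel_measurable borel"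
  using f by (auto simp: C1_on_def intro: borel_measurable_continuous_onI)

lemma G_measurable: "(\<lambda>(x, s). G x s) \<in> borel \<Otimes>\<^sub>M P \<rightarrow>\<^sub>M borel"
  using unbiased by (simp add: stochastic_oracle_def)

lemma noise_measurable: "(\<lambda>z. noise (fst z) (snd z)) \<in> borel \<Otimes>\<^sub>M P \<rightarrow>\<^sub>M borel"
  using G_measurable unfolding noise_def by (simp add: case_prod_beta')

lemma noise_comp [measurable (raw)]:
  assumes [measurable]: "X \<in> M \<rightarrow>\<^sub>M borel" "Y \<in> M \<rightarrow>\<^sub>M P"
  shows "(\<lambda>w. noise (X w) (Y w)) \<in> M \<rightarrow>\<^sub>M borel"
proof -
  have "(\<lambda>w. (X w, Y w)) \<in> M \<rightarrow>\<^sub>M borel \<Otimes>\<^sub>M P" by measurable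
  from measurable_compose[OF this noise_measurable] show ?thesis by simp
qed

lemma noise_integrable: "integrable P (noise x)"
  and noise_centered: "(\<integral>s. noise x s \<partial>P) = 0"
  and noise_moment_integrable: "integrable P (\<lambda>s. norm (noise x s) powr p)"
  and noise_moment: "(\<integral>s. norm (noise x s) powr p \<partial>P) \<le> \<sigma> powr p"
proof -
  interpret P: prob_space P using unbiased by (simp add: stochastic_oracle_def)
  have "integrable P (G x)" "(\<integral>s. G x s \<partial>P) = grad f x"
    using unbiased by (auto simp: stochastic_oracle_def)
  then show "integrable P (noise x)" "(\<integral>s. noise x s \<partial>P) = 0"
    by (simp_all add: noise_def[abs_def] P.prob_space)
qed (use unbiased in \<open>auto simp: stochastic_oracle_def noise_def\<close>)

end

locale fresh_noise = gradient_oracle f P G \<sigma> p + prob_space M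
  for f :: "'a::euclidean_space \<Rightarrow> real" and P :: "'s measure" and G \<sigma> p and M :: "'w measure" +
  fixes F :: "'w measure" and Y :: "'w \<Rightarrow> 's"
  assumes indep: "indep_set (sets F) (sets (vimage_algebra (space M) Y P))"
    and F: "space F = space M" and Y [measurable]: "Y \<in> M \<rightarrow>\<^sub>M P" and law: "distr M P Y = P"
begin

lemma P_prob: "prob_space P"
  using unbiased by (simp add: stochastic_oracle_def)

text \<open>
  Conditionally on the past the query point is a constant, for which the oracle's moment bound holds.
  Tonelli's theorem needs no prior integrability, so integrability is part of the conclusion.
\<close>
lemma fresh_noise_moment:
  assumes X: "X \<in> borel_measurable F"
  shows "integrable M (\<lambda>w. norm (noise (X w) (Y w)) powr p)"
    and "(\<integral>w. norm (noise (X w) (Y w)) powr p \<partial>M) \<le> \<sigma> powr p"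
proof -
  interpret P: prob_space P by (rule P_prob)
  note pair = distr_pair_of_indep[OF indep F X Y, unfolded law]
  note [measurable] = pair(1)
  interpret X: prob_space "distr M borel X" by (rule prob_space_distr) measurable
  let ?H = "\<lambda>z. ennreal (norm (noise (fst z) (snd z)) powr p)"
  have "(\<integral>\<^sup>+w. ennreal (norm (noise (X w) (Y w)) powr p) \<partial>M)
      = (\<integral>\<^sup>+z. ?H z \<partial>distr M (borel \<Otimes>\<^sub>M P) (\<lambda>w. (X w, Y w)))"
    by (subst nn_integral_distr) (use noise_measurable in \<open>auto intro!: measurable_compose[OF noise_measurable]\<close>)
  also have "\<dots> = (\<integral>\<^sup>+x. \<integral>\<^sup>+s. ?H (x, s) \<partial>P \<partial>distr M borel X)"
    unfolding pair(2) by (subst P.nn_integral_fst) (auto intro!: measurable_compose[OF noise_measurable])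
  also have "\<dots> \<le> (\<integral>\<^sup>+x. ennreal (\<sigma> powr p) \<partial>distr M borel X)"
  proof (rule nn_integral_mono)
    fix x
    have "(\<integral>\<^sup>+s. ?H (x, s) \<partial>P) = ennreal (\<integral>s. norm (noise x s) powr p \<partial>P)"
      using nn_integral_eq_integral[OF noise_moment_integrable] by simp
    then show "(\<integral>\<^sup>+s. ?H (x, s) \<partial>P) \<le> ennreal (\<sigma> powr p)"
      by (simp add: noise_moment ennreal_leI)
  qed
  also have "\<dots> = ennreal (\<sigma> powr p)" using X.emeasure_space_1 by simp
  finally have le: "(\<integral>\<^sup>+w. ennreal (norm (noise (X w) (Y w)) powr p) \<partial>M) \<le> ennreal (\<sigma> powr p)" .
  show "integrable M (\<lambda>w. norm (noise (X w) (Y w)) powr p)"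
  proof (rule integrableI_bounded)
    show "(\<integral>\<^sup>+w. ennreal (norm (norm (noise (X w) (Y w)) powr p)) \<partial>M) < \<infinity>"
      using le by (auto intro: le_less_trans)
  qed measurable
  show "(\<integral>w. norm (noise (X w) (Y w)) powr p \<partial>M) \<le> \<sigma> powr p"
    using le by (intro integral_real_bounded) auto
qed

text \<open>
  For a fixed past, \<open>A\<close> and the query point are constants and the noise has mean \<open>0\<close>.
\<close>
lemma fresh_noise_orthogonal:
  assumes A: "A \<in> borel_measurable F" and X: "X \<in> borel_measurable F"
    and int: "integrable M (\<lambda>w. A w \<bullet> noise (X w) (Y w))"
  shows "(\<integral>w. A w \<bullet> noise (X w) (Y w) \<partial>M) = 0"
proof -
  interpret P: prob_space P by (rule P_prob)
  have AX: "(\<lambda>w. (A w, X w)) \<in> F \<rightarrow>\<^sub>M borel \<Otimes>\<^sub>M borel"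
    using A X by measurable
  note pair = distr_pair_of_indep[OF indep F AX Y, unfolded law]
  let ?Q = "distr M (borel \<Otimes>\<^sub>M borel) (\<lambda>w. (A w, X w))"
  let ?H = "\<lambda>z. fst (fst z) \<bullet> noise (snd (fst z)) (snd z)"
  interpret Q: prob_space ?Q by (rule prob_space_distr[OF pair(1)])
  interpret PQ: pair_sigma_finite ?Q P ..
  have H: "?H \<in> borel_measurable ((borel \<Otimes>\<^sub>M borel) \<Otimes>\<^sub>M P)" by measurable
  have pm: "(\<lambda>w. ((A w, X w), Y w)) \<in> M \<rightarrow>\<^sub>M (borel \<Otimes>\<^sub>M borel) \<Otimes>\<^sub>M P"
    using pair(1) by measurable
  have "integrable (?Q \<Otimes>\<^sub>M P) ?H"
    unfolding pair(2)[symmetric] using int by (subst integrable_distr_eq[OF pm H]) simp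
  then have "(\<integral>z. (\<integral>s. ?H (z, s) \<partial>P) \<partial>?Q) = (\<integral>z. ?H z \<partial>(?Q \<Otimes>\<^sub>M P))"
    by (rule PQ.integral_fst')
  also have "\<dots> = (\<integral>w. A w \<bullet> noise (X w) (Y w) \<partial>M)"
    unfolding pair(2)[symmetric] by (subst integral_distr[OF pm H]) simp
  finally show ?thesis
    using noise_integrable noise_centered by (simp add: integral_inner_right)
qed

end

lemma (in prob_space) integrable_norm_of_powr:
  fixes Z :: "'a \<Rightarrow> 'b::euclidean_space"
  assumes [measurable]: "Z \<in> borel_measurable M" and int: "integrable M (\<lambda>w. norm (Z w) powr p)"
    and p: "1 < p" and c: "0 < c"
  shows "integrable M (\<lambda>w. norm (Z w))"
    and "(\<integral>w. norm (Z w) \<partial>M) \<le> c + c powr (1 - p) * (\<integral>w. norm (Z w) powr p \<partial>M)"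
proof -
  have bd: "norm (Z w) \<le> c + c powr (1 - p) * norm (Z w) powr p" for w
    using le_const_add_powr[OF p _ c] by simp
  have int': "integrable M (\<lambda>w. c + c powr (1 - p) * norm (Z w) powr p)"
    using int by simp
  show "integrable M (\<lambda>w. norm (Z w))"
    by (rule Bochner_Integration.integrable_bound[OF int']) (auto intro!: AE_I2 order_trans[OF bd])
  then have "(\<integral>w. norm (Z w) \<partial>M) \<le> (\<integral>w. c + c powr (1 - p) * norm (Z w) powr p \<partial>M)"
    using int' bd by (rule integral_mono)
  also have "\<dots> = c + c powr (1 - p) * (\<integral>w. norm (Z w) powr p \<partial>M)"
    using int by (simp add: prob_space)
  finally show "(\<integral>w. norm (Z w) \<partial>M) \<le> c + c powr (1 - p) * (\<integral>w. norm (Z w) powr p \<partial>M)" .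
qed

section \<open>The averaged noise\<close>

lemma space_past [simp]: "space (past M P \<xi> x k) = space M"
  by (simp add: past_def)

text \<open>
  The sigma-algebra of the past is generated by a map into a product space; its coordinates are
  therefore measurable.
\<close>
lemma past_measurable:
  assumes \<xi>: "\<And>i. \<xi> i \<in> M \<rightarrow>\<^sub>M P"
  shows sample_past_measurable: "i < k \<Longrightarrow> \<xi> i \<in> past M P \<xi> x k \<rightarrow>\<^sub>M P"
    and iterate_past_measurable: "i \<le> k \<Longrightarrow> x i \<in> borel_measurable (past M P \<xi> x k)"
proof -
  let ?h = "\<lambda>w. (\<lambda>i\<in>{..<k}. \<xi> i w, \<lambda>i\<in>{..k}. x i w)"
  let ?N = "PiM {..<k} (\<lambda>_. P) \<Otimes>\<^sub>M PiM {..k} (\<lambda>_. borel)"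
  have h: "?h \<in> past M P \<xi> x k \<rightarrow>\<^sub>M ?N"
    unfolding past_def
    by (rule measurable_vimage_algebra1)
      (auto simp: space_pair_measure space_PiM PiE_iff extensional_def intro: measurable_space[OF \<xi>] split: if_splits)
  show "\<xi> i \<in> past M P \<xi> x k \<rightarrow>\<^sub>M P" if "i < k"
  proof -
    have "(\<lambda>z. fst z i) \<in> ?N \<rightarrow>\<^sub>M P"
      using that by (intro measurable_compose[OF measurable_fst measurable_component_singleton]) auto
    from measurable_compose[OF h this] show ?thesis using that by simp
  qed
  show "x i \<in> borel_measurable (past M P \<xi> x k)" if "i \<le> k"
  proof -
    have "(\<lambda>z. snd z i) \<in> ?N \<rightarrow>\<^sub>M borel"
      using that by (intro measurable_compose[OF measurable_snd measurable_component_singleton]) auto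
    from measurable_compose[OF h this] show ?thesis using that by simp
  qed
qed

locale noisy_run = gradient_oracle f P G \<sigma> p + prob_space M
  for f :: "'a::euclidean_space \<Rightarrow> real" and P :: "'s measure" and G \<sigma> p and M :: "'w measure" +
  fixes \<xi> :: "nat \<Rightarrow> 'w \<Rightarrow> 's" and x :: "nat \<Rightarrow> 'w \<Rightarrow> 'a" and \<alpha> :: real
  assumes x_borel: "x k \<in> borel_measurable M"
    and fresh: "fresh_samples M P \<xi> x"
    and \<alpha>: "0 < \<alpha>" "\<alpha> \<le> 1"
begin

lemma sample_measurable: "\<xi> k \<in> M \<rightarrow>\<^sub>M P"
  using fresh by (auto simp: fresh_samples_def indep_vars_def)

lemma fresh_noise_at: "fresh_noise f P G \<sigma> p M (past M P \<xi> x k) (\<xi> k)"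
  using fresh sample_measurable by unfold_locales (auto simp: fresh_samples_def)

lemma noise_along_run_moment:
  shows "integrable M (\<lambda>w. norm (noise (x k w) (\<xi> k w)) powr p)"
    and "(\<integral>w. norm (noise (x k w) (\<xi> k w)) powr p \<partial>M) \<le> \<sigma> powr p"
  using fresh_noise.fresh_noise_moment[OF fresh_noise_at iterate_past_measurable[OF sample_measurable]]
  by auto

text \<open>
  The martingale part of the tracking error: noise enters with the weights of the averaging, from the
  sample with index \<open>1\<close> on.
\<close>
primrec averaged_noise :: "nat \<Rightarrow> 'w \<Rightarrow> 'a" where
  "averaged_noise 0 w = 0"
| "averaged_noise (Suc k) w = (1 - \<alpha>) *\<^sub>R averaged_noise k w + \<alpha> *\<^sub>R noise (x (Suc k) w) (\<xi> (Suc k) w)"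

lemma averaged_noise_past_measurable:
  "i < k \<Longrightarrow> averaged_noise i \<in> borel_measurable (past M P \<xi> x k)"
proof (induction i)
  case 0
  have "averaged_noise 0 = (\<lambda>_. 0)" by (rule ext) simp
  then show ?case by simp
next
  case (Suc i)
  then have [measurable]: "averaged_noise i \<in> borel_measurable (past M P \<xi> x k)"
    "x (Suc i) \<in> borel_measurable (past M P \<xi> x k)" "\<xi> (Suc i) \<in> past M P \<xi> x k \<rightarrow>\<^sub>M P"
    using iterate_past_measurable[where \<xi> = \<xi> and x = x, OF sample_measurable, of "Suc i" k]
      sample_past_measurable[where \<xi> = \<xi>, OF sample_measurable] by auto
  have "averaged_noise (Suc i) = (\<lambda>w. (1 - \<alpha>) *\<^sub>R averaged_noise i w + \<alpha> *\<^sub>R noise (x (Suc i) w) (\<xi> (Suc i) w))"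
    by (rule ext) simp
  then show ?case by simp
qed

lemma averaged_noise_measurable: "averaged_noise k \<in> borel_measurable M"
proof -
  interpret F: fresh_noise f P G \<sigma> p M "past M P \<xi> x (Suc k)" "\<xi> (Suc k)" by (rule fresh_noise_at)
  show ?thesis
    using distr_pair_of_indep(1)[OF F.indep F.F averaged_noise_past_measurable[OF lessI] F.Y] .
qed

text \<open>
  Each step shrinks the \<open>p\<close>-th moment by the factor \<open>1 - \<alpha>\<close> (as \<open>(1 - \<alpha>)\<^sup>p \<le> 1 - \<alpha>\<close>) and adds at most
  \<open>6 \<alpha>\<^sup>p \<sigma>\<^sup>p\<close>, since the linear term of \<open>norm_add_powr_le\<close> is orthogonal to the fresh noise. The bound is the
  fixed point of this recursion. Starting the martingale at \<open>0\<close> instead of the first noise makes it hold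
  for all \<open>k\<close>; the first noise is not weighted by \<open>\<alpha>\<close> and in general too large for it.
\<close>
lemma averaged_noise_moment:
  "integrable M (\<lambda>w. norm (averaged_noise k w) powr p) \<and>
   (\<integral>w. norm (averaged_noise k w) powr p \<partial>M) \<le> 6 * \<alpha> powr (p - 1) * \<sigma> powr p"
proof (induction k)
  case 0
  then show ?case by simp
next
  case (Suc k)
  interpret F: fresh_noise f P G \<sigma> p M "past M P \<xi> x (Suc k)" "\<xi> (Suc k)" by (rule fresh_noise_at)
  define a n where "a w = (1 - \<alpha>) *\<^sub>R averaged_noise k w" and "n w = noise (x (Suc k) w) (\<xi> (Suc k) w)" for w
  define A where "A w = (p * \<alpha> * norm (a w) powr (p - 2)) *\<^sub>R a w" for w
  have S: "averaged_noise (Suc k) w = a w + \<alpha> *\<^sub>R n w" for w by (simp add: a_def n_def)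
  have Sk_past [measurable]: "averaged_noise k \<in> borel_measurable (past M P \<xi> x (Suc k))"
    by (rule averaged_noise_past_measurable) simp
  have A_past: "A \<in> borel_measurable (past M P \<xi> x (Suc k))"
    unfolding A_def a_def by measurable
  have x_past: "x (Suc k) \<in> borel_measurable (past M P \<xi> x (Suc k))"
    by (rule iterate_past_measurable[OF sample_measurable]) simp
  note [measurable] = averaged_noise_measurable x_borel sample_measurable
  have [measurable]: "a \<in> borel_measurable M" "n \<in> borel_measurable M"
    unfolding a_def n_def by measurable
  then have [measurable]: "A \<in> borel_measurable M" unfolding A_def by measurable
  have n_int: "integrable M (\<lambda>w. norm (n w) powr p)" and n_le: "(\<integral>w. norm (n w) powr p \<partial>M) \<le> \<sigma> powr p"
    using noise_along_run_moment[of "Suc k"] by (simp_all add: n_def)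
  have S_int: "integrable M (\<lambda>w. norm (averaged_noise k w) powr p)" using Suc by simp
  have a_eq: "norm (a w) powr p = (1 - \<alpha>) powr p * norm (averaged_noise k w) powr p" for w
    using \<alpha> by (simp add: a_def powr_mult)
  then have a_int: "integrable M (\<lambda>w. norm (a w) powr p)" using S_int by simp
  \<comment> \<open>each of the factors of \<open>\<parallel>a\<parallel> powr (p - 1) * \<parallel>n\<parallel>\<close> is at most the matching power of the larger norm\<close>
  have A_n_bound: "\<bar>A w \<bullet> n w\<bar> \<le> p * \<alpha> * (norm (a w) powr p + norm (n w) powr p)" for w
  proof -
    have "norm (a w) powr (p - 2) * norm (a w) * norm (n w) \<le> norm (a w) powr p + norm (n w) powr p"
    proof (cases "a w = 0")
      case False
      define m where "m = max (norm (a w)) (norm (n w))"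
      have m: "norm (a w) \<le> m" "norm (n w) \<le> m" "0 < m" using False by (auto simp: m_def less_max_iff_disj)
      have "norm (a w) powr (p - 2) * norm (a w) * norm (n w) = norm (a w) powr (p - 1) * norm (n w)"
        using False powr_add[of "norm (a w)" "p - 2" 1] by simp
      also have "\<dots> \<le> m powr (p - 1) * m"
        using m p by (intro mult_mono powr_mono2) auto
      also have "\<dots> = m powr p" using m powr_add[of m "p - 1" 1] by simp
      also have "\<dots> \<le> norm (a w) powr p + norm (n w) powr p" by (auto simp: m_def max_def)
      finally show ?thesis .
    qed simp
    then have "p * \<alpha> * (norm (a w) powr (p - 2) * norm (a w) * norm (n w))
        \<le> p * \<alpha> * (norm (a w) powr p + norm (n w) powr p)"
      using p \<alpha> by (intro mult_left_mono) auto
    moreover have "\<bar>A w \<bullet> n w\<bar> \<le> norm (A w) * norm (n w)" by (rule Cauchy_Schwarz_ineq2)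
    moreover have "norm (A w) * norm (n w) = p * \<alpha> * (norm (a w) powr (p - 2) * norm (a w) * norm (n w))"
      using p \<alpha> by (simp add: A_def)
    ultimately show ?thesis by linarith
  qed
  have An_int: "integrable M (\<lambda>w. A w \<bullet> n w)"
    by (rule Bochner_Integration.integrable_bound[of M "\<lambda>w. p * \<alpha> * (norm (a w) powr p + norm (n w) powr p)"])
      (use a_int n_int A_n_bound in \<open>auto intro!: AE_I2 order_trans[OF A_n_bound abs_ge_self]\<close>)
  have An_zero: "(\<integral>w. A w \<bullet> n w \<partial>M) = 0"
    using F.fresh_noise_orthogonal[OF A_past x_past] An_int by (simp add: n_def)
  let ?R = "\<lambda>w. norm (a w) powr p + A w \<bullet> n w + 6 * \<alpha> powr p * norm (n w) powr p"
  have step: "norm (averaged_noise (Suc k) w) powr p \<le> ?R w" for w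
    using norm_add_powr_le[OF p, of "a w" "\<alpha> *\<^sub>R n w"] \<alpha> unfolding S
    by (simp add: A_def powr_mult algebra_simps)
  have R_int: "integrable M ?R" using a_int n_int An_int by simp
  have int: "integrable M (\<lambda>w. norm (averaged_noise (Suc k) w) powr p)"
    by (rule Bochner_Integration.integrable_bound[OF R_int])
      (auto intro!: AE_I2 order_trans[OF step abs_ge_self] simp del: averaged_noise.simps)
  moreover have "(\<integral>w. norm (averaged_noise (Suc k) w) powr p \<partial>M) \<le> 6 * \<alpha> powr (p - 1) * \<sigma> powr p"
  proof -
    have "(\<integral>w. norm (averaged_noise (Suc k) w) powr p \<partial>M) \<le> (\<integral>w. ?R w \<partial>M)"
      using int R_int step by (rule integral_mono)
    also have "\<dots> = (1 - \<alpha>) powr p * (\<integral>w. norm (averaged_noise k w) powr p \<partial>M)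
        + 6 * \<alpha> powr p * (\<integral>w. norm (n w) powr p \<partial>M)"
      using a_int n_int An_int An_zero by (simp add: a_eq)
    also have "\<dots> \<le> (1 - \<alpha>) * (6 * \<alpha> powr (p - 1) * \<sigma> powr p) + 6 * \<alpha> powr p * \<sigma> powr p"
    proof (intro add_mono mult_mono)
      show "(1 - \<alpha>) powr p \<le> 1 - \<alpha>"
        using powr_mono'[of 1 p "1 - \<alpha>"] \<alpha> p by simp
    qed (use \<alpha> n_le Suc in auto)
    also have "\<dots> = 6 * \<alpha> powr (p - 1) * \<sigma> powr p"
      using \<alpha> powr_add[of \<alpha> "p - 1" 1] by (simp add: algebra_simps)
    finally show ?thesis .
  qed
  ultimately show ?case by blast
qed

end

section \<open>Tracking error of the averaged gradient\<close>

context noisy_run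
begin

text \<open>
  What remains of the tracking error besides the martingale obeys
  \<open>T (Suc k) = (1 - \<alpha>)(T k - (\<nabla>f(x (Suc k)) - \<nabla>f(x k)))\<close>. It forgets its initial value, the noise of the first
  sample, geometrically, and a drift of at most \<open>B\<close> per step accumulates to at most \<open>B/\<alpha>\<close>.
\<close>
lemma tracking_error_pathwise:
  assumes d0: "d 0 w = G (x 0 w) (\<xi> 0 w)"
    and d_Suc: "\<And>k. d (Suc k) w = \<alpha> *\<^sub>R G (x (Suc k) w) (\<xi> (Suc k) w) + (1 - \<alpha>) *\<^sub>R d k w"
    and drift: "\<And>k. norm (grad f (x (Suc k) w) - grad f (x k w)) \<le> B"
  shows "norm (d k w - grad f (x k w) - averaged_noise k w)
      \<le> (1 - \<alpha>) ^ k * norm (noise (x 0 w) (\<xi> 0 w)) + B / \<alpha>"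
proof (induction k)
  case 0
  have "0 \<le> B" using drift[of 0] norm_ge_zero order_trans by blast
  then show ?case using \<alpha> by (simp add: d0 noise_def)
next
  case (Suc k)
  let ?T = "\<lambda>k. d k w - grad f (x k w) - averaged_noise k w"
  let ?n = "norm (noise (x 0 w) (\<xi> 0 w))"
  have B: "0 \<le> B" using drift[of 0] norm_ge_zero order_trans by blast
  have "?T (Suc k) = (1 - \<alpha>) *\<^sub>R (?T k - (grad f (x (Suc k) w) - grad f (x k w)))"
    by (simp add: d_Suc noise_def algebra_simps)
  then have "norm (?T (Suc k)) = (1 - \<alpha>) * norm (?T k - (grad f (x (Suc k) w) - grad f (x k w)))"
    using \<alpha> by simp
  also have "\<dots> \<le> (1 - \<alpha>) * (((1 - \<alpha>) ^ k * ?n + B / \<alpha>) + B)"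
  proof (rule mult_left_mono)
    show "norm (?T k - (grad f (x (Suc k) w) - grad f (x k w))) \<le> ((1 - \<alpha>) ^ k * ?n + B / \<alpha>) + B"
      using norm_triangle_ineq4[of "?T k" "grad f (x (Suc k) w) - grad f (x k w)"] Suc drift[of k]
      by linarith
  qed (use \<alpha> in simp)
  also have "\<dots> = (1 - \<alpha>) ^ Suc k * ?n + (B / \<alpha> - \<alpha> * B)"
    using \<alpha> by (simp add: field_simps)
  also have "\<dots> \<le> (1 - \<alpha>) ^ Suc k * ?n + B / \<alpha>"
    using \<alpha> B by simp
  finally show ?case .
qed

text \<open>
  The constant \<open>c = \<alpha> powr ((p - 1)/p)\<close> is the order of the \<open>L\<^sup>p\<close> norm of the averaged noise, so that both
  summands of \<open>le_const_add_powr\<close> come out as multiples of \<open>c\<close>.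
\<close>
lemma averaged_noise_norm:
  "integrable M (\<lambda>w. norm (averaged_noise k w))"
  "(\<integral>w. norm (averaged_noise k w) \<partial>M) \<le> (1 + 6 * \<sigma> powr p) * \<alpha> powr ((p - 1) / p)"
proof -
  define c where "c = \<alpha> powr ((p - 1) / p)"
  have c: "0 < c" using \<alpha> by (simp add: c_def)
  note S = averaged_noise_moment[of k]
  note N = integrable_norm_of_powr[OF averaged_noise_measurable conjunct1[OF S] p(1) c]
  show "integrable M (\<lambda>w. norm (averaged_noise k w))" by (rule N(1))
  have "c powr (1 - p) * \<alpha> powr (p - 1) = \<alpha> powr ((p - 1) / p * (1 - p) + (p - 1))"
    by (simp add: c_def powr_powr powr_add)
  also have "(p - 1) / p * (1 - p) + (p - 1) = (p - 1) / p"
    using p by (simp add: field_simps)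
  finally have cp: "c powr (1 - p) * \<alpha> powr (p - 1) = c" by (simp add: c_def)
  have "(\<integral>w. norm (averaged_noise k w) \<partial>M) \<le> c + c powr (1 - p) * (6 * \<alpha> powr (p - 1) * \<sigma> powr p)"
    using N(2) mult_left_mono[OF conjunct2[OF S], of "c powr (1 - p)"] by simp
  also have "\<dots> = c + 6 * \<sigma> powr p * (c powr (1 - p) * \<alpha> powr (p - 1))" by (simp add: mult_ac)
  also have "\<dots> = (1 + 6 * \<sigma> powr p) * \<alpha> powr ((p - 1) / p)"
    unfolding cp by (simp add: c_def algebra_simps)
  finally show "(\<integral>w. norm (averaged_noise k w) \<partial>M) \<le> (1 + 6 * \<sigma> powr p) * \<alpha> powr ((p - 1) / p)" .
qed

text \<open>
  The recursion is assumed on the underlying space of \<open>M\<close> only, where it determines the directions from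
  iterates and samples.
\<close>
lemma direction_measurable:
  assumes d0: "\<And>w. w \<in> space M \<Longrightarrow> d 0 w = G (x 0 w) (\<xi> 0 w)"
    and d_Suc: "\<And>k w. w \<in> space M \<Longrightarrow>
        d (Suc k) w = \<alpha> *\<^sub>R G (x (Suc k) w) (\<xi> (Suc k) w) + (1 - \<alpha>) *\<^sub>R d k w"
  shows "d k \<in> borel_measurable M"
proof -
  have Gm: "(\<lambda>w. G (x k w) (\<xi> k w)) \<in> borel_measurable M" for k
  proof -
    have "(\<lambda>w. (x k w, \<xi> k w)) \<in> M \<rightarrow>\<^sub>M borel \<Otimes>\<^sub>M P"
      using x_borel sample_measurable by (rule measurable_Pair)
    from measurable_compose[OF this G_measurable] show ?thesis by simp
  qed
  show ?thesis
  proof (induction k)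
    case 0
    show ?case by (rule iffD2[OF measurable_cong[OF d0] Gm])
  next
    case (Suc k)
    have "(\<lambda>w. \<alpha> *\<^sub>R G (x (Suc k) w) (\<xi> (Suc k) w) + (1 - \<alpha>) *\<^sub>R d k w) \<in> borel_measurable M"
      using Suc Gm[of "Suc k"] by measurable
    moreover have "d (Suc k) \<in> borel_measurable M \<longleftrightarrow>
        (\<lambda>w. \<alpha> *\<^sub>R G (x (Suc k) w) (\<xi> (Suc k) w) + (1 - \<alpha>) *\<^sub>R d k w) \<in> borel_measurable M"
      by (rule measurable_cong) (rule d_Suc)
    ultimately show ?case by blast
  qed
qed

lemma expected_tracking_error:
  assumes d0: "\<And>w. w \<in> space M \<Longrightarrow> d 0 w = G (x 0 w) (\<xi> 0 w)"
    and d_Suc: "\<And>k w. w \<in> space M \<Longrightarrow>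
        d (Suc k) w = \<alpha> *\<^sub>R G (x (Suc k) w) (\<xi> (Suc k) w) + (1 - \<alpha>) *\<^sub>R d k w"
    and drift: "\<And>k w. w \<in> space M \<Longrightarrow> norm (grad f (x (Suc k) w) - grad f (x k w)) \<le> B"
  shows "integrable M (\<lambda>w. norm (d k w - grad f (x k w)))"
    and "(\<integral>w. norm (d k w - grad f (x k w)) \<partial>M)
      \<le> (1 + 6 * \<sigma> powr p) * \<alpha> powr ((p - 1) / p) + (1 - \<alpha>) ^ k * (1 + \<sigma> powr p) + B / \<alpha>"
proof -
  note [measurable] = direction_measurable[OF d0 d_Suc, simplified] x_borel sample_measurable
  let ?e = "\<lambda>w. norm (d k w - grad f (x k w))"
  let ?n = "\<lambda>w. norm (noise (x 0 w) (\<xi> 0 w))"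
  let ?R = "\<lambda>w. norm (averaged_noise k w) + (1 - \<alpha>) ^ k * ?n w + B / \<alpha>"
  have bd: "?e w \<le> ?R w" if "w \<in> space M" for w
    using tracking_error_pathwise[of d w B k, OF d0[OF that] d_Suc[OF that] drift[OF that]]
      norm_triangle_ineq2[of "d k w - grad f (x k w)" "averaged_noise k w"]
    by linarith
  have n_meas: "(\<lambda>w. noise (x 0 w) (\<xi> 0 w)) \<in> borel_measurable M" by measurable
  note n = integrable_norm_of_powr[OF n_meas noise_along_run_moment(1) p(1) zero_less_one]
  have n_le: "(\<integral>w. ?n w \<partial>M) \<le> 1 + \<sigma> powr p"
    using n(2) noise_along_run_moment(2)[of 0] by simp
  have R_int: "integrable M ?R" using averaged_noise_norm(1) n(1) by simp
  show int: "integrable M ?e"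
    by (rule Bochner_Integration.integrable_bound[OF R_int])
      (measurable, auto intro!: AE_I2 order_trans[OF bd abs_ge_self])
  have "(\<integral>w. ?e w \<partial>M) \<le> (\<integral>w. ?R w \<partial>M)" using int R_int bd by (rule integral_mono)
  also have "\<dots> = (\<integral>w. norm (averaged_noise k w) \<partial>M) + (1 - \<alpha>) ^ k * (\<integral>w. ?n w \<partial>M) + B / \<alpha>"
    using averaged_noise_norm(1) n(1) by (simp add: prob_space)
  also have "\<dots> \<le> (1 + 6 * \<sigma> powr p) * \<alpha> powr ((p - 1) / p) + (1 - \<alpha>) ^ k * (1 + \<sigma> powr p) + B / \<alpha>"
    using averaged_noise_norm(2) n_le \<alpha> by (intro add_mono mult_left_mono order_refl) auto
  finally show "(\<integral>w. ?e w \<partial>M)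
      \<le> (1 + 6 * \<sigma> powr p) * \<alpha> powr ((p - 1) / p) + (1 - \<alpha>) ^ k * (1 + \<sigma> powr p) + B / \<alpha>" .
qed

end

section \<open>The averaged stationarity gap\<close>

text \<open>
  The one-step inequality is summed path by path before taking expectations. On each path the
  values of \<open>F\<close> telescope to at most \<open>F(x0) - m\<close>. Since gaps are nonnegative, each one is dominated by the
  integrable bound on the sum and so is integrable itself.
\<close>
lemma (in bounded_reference) expected_gap_sum:
  fixes f :: "'a \<Rightarrow> real" and g :: "'a \<Rightarrow> ereal" and M :: "'w measure"
  assumes f: "C1_on UNIV f" and L: "L-lipschitz_on UNIV (grad f)"
    and g: "proper_fun g" and low: "\<And>z. z \<in> edom g \<Longrightarrow> m \<le> f z + real_of_ereal (g z)"
    and x0: "x0 \<in> edom g"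
    and orc: "stochastic_oracle f P G \<sigma> p" and p: "1 < p" "p \<le> 2"
    and \<gamma>: "0 < \<gamma>" and \<alpha>: "0 < \<alpha>" "\<alpha> \<le> 1"
    and run: "algorithm_run g \<phi> P G \<alpha> \<gamma> x0 M \<xi> x y d v"
  shows "integrable M (\<lambda>w. gap f \<phi> (x (Suc k) w) (v k w))"
    and "\<gamma> * (\<Sum>k=0..K. \<integral>w. gap f \<phi> (x (Suc k) w) (v k w) \<partial>M)
      \<le> (f x0 + real_of_ereal (g x0) - m)
        + 2 * D * \<gamma> * ((real K + 1) * ((1 + 6 * \<sigma> powr p) * \<alpha> powr ((p - 1) / p) + L * (2 * D * \<gamma>) / \<alpha>)
            + (1 + \<sigma> powr p) / \<alpha>)
        + (real K + 1) * (8 * L * D\<^sup>2 * \<gamma>\<^sup>2)"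
proof -
  have M: "prob_space M" and xm: "\<And>k. x k \<in> borel_measurable M" and fresh: "fresh_samples M P \<xi> x"
    using run by (auto simp: algorithm_run_def)
  interpret N: noisy_run f P G \<sigma> p M \<xi> x \<alpha>
    using f orc p M xm fresh \<alpha>
    by (auto simp: noisy_run_def noisy_run_axioms_def gradient_oracle_def)
  have x_0: "\<And>w. w \<in> space M \<Longrightarrow> x 0 w = x0"
    and d0: "\<And>w. w \<in> space M \<Longrightarrow> d 0 w = G (x 0 w) (\<xi> 0 w)"
    and d_Suc: "\<And>k w. w \<in> space M \<Longrightarrow>
        d (Suc k) w = \<alpha> *\<^sub>R G (x (Suc k) w) (\<xi> (Suc k) w) + (1 - \<alpha>) *\<^sub>R d k w"
    and y: "\<And>k w. w \<in> space M \<Longrightarrow> y k w = x k w - \<gamma> *\<^sub>R mirror (d k w)"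
    and mini: "\<And>k w. w \<in> space M \<Longrightarrow>
        is_arg_min (\<lambda>z. g z + epi_scale \<gamma> \<phi> (z - y k w)) (\<lambda>_. True) (x (Suc k) w)"
    and bs: "\<And>k w. w \<in> space M \<Longrightarrow> backward_subgradient g \<phi> \<gamma> (y k w) (x (Suc k) w) (v k w)"
    using run by (auto simp: algorithm_run_def)
  define gp where "gp k w = gap f \<phi> (x (Suc k) w) (v k w)" for k w
  define err where "err k w = norm (d k w - grad f (x k w))" for k w
  define Fv where "Fv z = f z + real_of_ereal (g z)" for z
  define c where "c = 8 * L * D\<^sup>2 * \<gamma>\<^sup>2"
  have dom: "x k w \<in> edom g" if w: "w \<in> space M" for k w
  proof (induction k)
    case (Suc k)
    then show ?case by (rule backward_step_in_dom[OF f L g \<gamma> y[OF w] mini[OF w] bs[OF w]])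
  qed (simp add: x_0 w x0)
  have step: "norm (x (Suc k) w - x k w) \<le> 2 * D * \<gamma>" "0 \<le> gp k w"
    "\<gamma> * gp k w \<le> Fv (x k w) - Fv (x (Suc k) w) + 2 * D * \<gamma> * err k w + c"
    "gp k w = conj_r (grad f (x (Suc k) w)) + phi_r ((x (Suc k) w - y k w) /\<^sub>R \<gamma>)
        - grad f (x (Suc k) w) \<bullet> ((x (Suc k) w - y k w) /\<^sub>R \<gamma>)" if w: "w \<in> space M" for k w
    unfolding gp_def err_def Fv_def c_def
    using forward_backward_step(2-5)[OF f L g \<gamma> y[OF w] mini[OF w] bs[OF w] dom[OF w]] by auto
  have drift: "norm (grad f (x (Suc k) w) - grad f (x k w)) \<le> L * (2 * D * \<gamma>)" if w: "w \<in> space M" for k w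
    using lipschitz_onD[OF L, of "x (Suc k) w" "x k w"]
      mult_left_mono[OF step(1)[OF w] lipschitz_on_nonneg[OF L], of k] by (simp add: dist_norm)
  have err_int: "integrable M (err k)"
    and err_le: "(\<integral>w. err k w \<partial>M)
      \<le> (1 + 6 * \<sigma> powr p) * \<alpha> powr ((p - 1) / p) + (1 - \<alpha>) ^ k * (1 + \<sigma> powr p) + L * (2 * D * \<gamma>) / \<alpha>" for k
    using N.expected_tracking_error[OF d0 d_Suc drift] by (auto simp: err_def[abs_def])
  have sum_bound: "\<gamma> * (\<Sum>k=0..K. gp k w) \<le> Fv x0 - m + 2 * D * \<gamma> * (\<Sum>k=0..K. err k w) + (real K + 1) * c"
    if w: "w \<in> space M" for w K
  proof -
    have "\<gamma> * (\<Sum>k=0..K. gp k w) \<le> Fv x0 - Fv (x (Suc K) w) + 2 * D * \<gamma> * (\<Sum>k=0..K. err k w) + (real K + 1) * c"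
    proof (induction K)
      case 0
      then show ?case using step(3)[OF w, of 0] x_0[OF w] by simp
    next
      case (Suc K)
      then show ?case using step(3)[OF w, of "Suc K"] by (simp add: algebra_simps)
    qed
    then show ?thesis using low[OF dom[OF w, of "Suc K"]] by (simp add: Fv_def)
  qed
  have gp_meas: "gp k \<in> borel_measurable M" for k
  proof -
    note [measurable] = N.direction_measurable[OF d0 d_Suc, simplified] xm
    have [measurable]: "mirror \<in> borel_measurable borel" "conj_r \<in> borel_measurable borel"
      using continuous_mirror continuous_conjugate by (auto intro: borel_measurable_continuous_onI)
    have [measurable]: "\<phi> \<in> borel_measurable borel" by (rule lsc_fun_borel_measurable[OF phi_lsc])
    define u where "u w = (x (Suc k) w - (x k w - \<gamma> *\<^sub>R mirror (d k w))) /\<^sub>R \<gamma>" for w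
    have [measurable]: "u \<in> borel_measurable M" unfolding u_def by measurable
    have "(\<lambda>w. conj_r (grad f (x (Suc k) w)) + phi_r (u w) - grad f (x (Suc k) w) \<bullet> u w) \<in> borel_measurable M"
      by measurable
    moreover have "gp k w = conj_r (grad f (x (Suc k) w)) + phi_r (u w) - grad f (x (Suc k) w) \<bullet> u w"
      if "w \<in> space M" for w
      using step(4)[OF that] y[OF that] by (simp add: u_def)
    ultimately show ?thesis by (rule iffD2[OF measurable_cong, rotated])
  qed
  have gp_int: "integrable M (gp k)" for k
  proof -
    let ?R = "\<lambda>w. (Fv x0 - m + 2 * D * \<gamma> * (\<Sum>j=0..k. err j w) + (real k + 1) * c) / \<gamma>"
    have "integrable M ?R" using err_int by simp
    moreover have "AE w in M. norm (gp k w) \<le> norm (?R w)"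
    proof (rule AE_I2)
      fix w assume w: "w \<in> space M"
      have "gp k w \<le> (\<Sum>j=0..k. gp j w)"
        using step(2)[OF w] by (intro member_le_sum) auto
      also have "\<dots> \<le> ?R w"
        using sum_bound[OF w, of k] \<gamma> by (simp add: pos_le_divide_eq mult.commute)
      also have "\<dots> \<le> norm (?R w)" unfolding real_norm_def by (rule abs_ge_self)
      finally show "norm (gp k w) \<le> norm (?R w)" using step(2)[OF w, of k] by simp
    qed
    ultimately show ?thesis by (rule Bochner_Integration.integrable_bound[OF _ gp_meas])
  qed
  then show "integrable M (\<lambda>w. gap f \<phi> (x (Suc k) w) (v k w))" by (simp add: gp_def[abs_def])
  have "\<gamma> * (\<Sum>k=0..K. \<integral>w. gp k w \<partial>M) = (\<integral>w. \<gamma> * (\<Sum>k=0..K. gp k w) \<partial>M)"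
    using gp_int by simp
  also have "\<dots> \<le> (\<integral>w. Fv x0 - m + 2 * D * \<gamma> * (\<Sum>k=0..K. err k w) + (real K + 1) * c \<partial>M)"
    using gp_int err_int sum_bound by (intro integral_mono) auto
  also have "\<dots> = Fv x0 - m + 2 * D * \<gamma> * (\<Sum>k=0..K. \<integral>w. err k w \<partial>M) + (real K + 1) * c"
    using err_int by (simp add: N.prob_space)
  also have "(\<Sum>k=0..K. \<integral>w. err k w \<partial>M)
      \<le> (\<Sum>k=0..K. ((1 + 6 * \<sigma> powr p) * \<alpha> powr ((p - 1) / p) + L * (2 * D * \<gamma>) / \<alpha>)
          + (1 - \<alpha>) ^ k * (1 + \<sigma> powr p))"
    using err_le by (intro sum_mono) (simp add: algebra_simps)
  also have "\<dots> = (real K + 1) * ((1 + 6 * \<sigma> powr p) * \<alpha> powr ((p - 1) / p) + L * (2 * D * \<gamma>) / \<alpha>)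
      + (\<Sum>k\<le>K. (1 - \<alpha>) ^ k) * (1 + \<sigma> powr p)"
    by (simp add: sum.distrib sum_distrib_right atLeast0AtMost add.commute)
  also have "\<dots> \<le> (real K + 1) * ((1 + 6 * \<sigma> powr p) * \<alpha> powr ((p - 1) / p) + L * (2 * D * \<gamma>) / \<alpha>)
      + (1 + \<sigma> powr p) / \<alpha>"
  proof -
    have "\<alpha> * (\<Sum>k\<le>K. (1 - \<alpha>) ^ k) = 1 - (1 - \<alpha>) ^ Suc K"
      using sum_gp_basic[of "1 - \<alpha>" K] by simp
    also have "\<dots> \<le> 1" using \<alpha> by simp
    finally have "(\<Sum>k\<le>K. (1 - \<alpha>) ^ k) \<le> 1 / \<alpha>" using \<alpha> by (simp add: pos_le_divide_eq mult.commute)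
    then have "(\<Sum>k\<le>K. (1 - \<alpha>) ^ k) * (1 + \<sigma> powr p) \<le> 1 / \<alpha> * (1 + \<sigma> powr p)"
      by (rule mult_right_mono) simp
    then show ?thesis by simp
  qed
  finally show "\<gamma> * (\<Sum>k=0..K. \<integral>w. gap f \<phi> (x (Suc k) w) (v k w) \<partial>M)
      \<le> (f x0 + real_of_ereal (g x0) - m)
        + 2 * D * \<gamma> * ((real K + 1) * ((1 + 6 * \<sigma> powr p) * \<alpha> powr ((p - 1) / p) + L * (2 * D * \<gamma>) / \<alpha>)
            + (1 + \<sigma> powr p) / \<alpha>)
        + (real K + 1) * (8 * L * D\<^sup>2 * \<gamma>\<^sup>2)"
    using \<gamma> D_nonneg by (simp add: gp_def Fv_def c_def mult_left_mono)
qed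

text \<open>
  With \<open>N = K + 1\<close>, dividing by \<open>\<gamma> N\<close> leaves five powers of \<open>N\<close>: \<open>1/(\<gamma> N)\<close> and \<open>\<gamma>/\<alpha>\<close> decay like
  \<open>N powr -(1/4)\<close>, while \<open>1/(\<alpha> N)\<close> and \<open>\<gamma>\<close> decay faster. The noise term decays like \<open>N powr -((p - 1)/(2 p))\<close>. For
  \<open>p = 2\<close> it joins the first two, and this threefold balance determines the exponents \<open>3/4\<close> and \<open>1/2\<close>.
\<close>
lemma rate_arithmetic:
  fixes K :: nat and S \<Delta> E n D L \<gamma>bar p :: real
  assumes nonneg: "0 \<le> \<Delta>" "0 \<le> E" "0 \<le> n" "0 \<le> D" "0 \<le> L" and gb: "0 < \<gamma>bar" and p: "1 < p"
    and \<alpha>: "\<alpha> = (real K + 1) powr (- (1/2))"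
    and \<gamma>: "\<gamma> = \<gamma>bar * (real K + 1) powr (- (3/4))"
    and S: "\<gamma> * S \<le> \<Delta> + 2 * D * \<gamma> * ((real K + 1) * (E * \<alpha> powr ((p - 1) / p) + L * (2 * D * \<gamma>) / \<alpha>) + n / \<alpha>)
        + (real K + 1) * (8 * L * D\<^sup>2 * \<gamma>\<^sup>2)"
  shows "1 / (real K + 1) * S \<le> (\<Delta> / \<gamma>bar + 2 * D * (E + 2 * L * D * \<gamma>bar + n) + 8 * L * D\<^sup>2 * \<gamma>bar)
      * (real K + 1) powr (- min (1/4) ((p - 1) / (2 * p)))"
proof -
  define N where "N = real K + 1"
  define R where "R = N powr (- min (1/4) ((p - 1) / (2 * p)))"
  have N: "1 \<le> N" by (simp add: N_def)
  have le_R: "N powr - s \<le> R" if "min (1/4) ((p - 1) / (2 * p)) \<le> s" for s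
    unfolding R_def using that N by (intro powr_mono) auto
  have \<gamma>_pos: "0 < \<gamma>" using gb N by (simp add: \<gamma> N_def)
  have \<alpha>_pos: "0 < \<alpha>" using N by (simp add: \<alpha> N_def)
  have 1: "1 / (\<gamma> * N) \<le> R / \<gamma>bar"
  proof -
    have "\<gamma> * N = \<gamma>bar * N powr (1/4)"
      using N powr_add[of N "-(3/4)" 1] by (simp add: \<gamma> N_def)
    then have "1 / (\<gamma> * N) = N powr - (1/4) / \<gamma>bar"
      by (simp only: powr_minus_divide) simp
    then show ?thesis using le_R[of "1/4"] gb by (simp add: divide_right_mono)
  qed
  have 2: "\<alpha> powr ((p - 1) / p) \<le> R"
  proof -
    have "\<alpha> powr ((p - 1) / p) = N powr - ((p - 1) / (2 * p))"
      using p by (simp add: \<alpha> N_def powr_powr field_simps)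
    then show ?thesis using le_R[of "(p - 1) / (2 * p)"] by simp
  qed
  have 3: "1 / (\<alpha> * N) \<le> R"
  proof -
    have "\<alpha> * N = N powr (1/2)" using N powr_add[of N "-(1/2)" 1] by (simp add: \<alpha> N_def)
    then have "1 / (\<alpha> * N) = N powr - (1/2)" by (simp only: powr_minus_divide)
    then show ?thesis using le_R[of "1/2"] by simp
  qed
  have 4: "\<gamma> / \<alpha> \<le> \<gamma>bar * R"
  proof -
    have "\<gamma> / \<alpha> = \<gamma>bar * N powr (- (3/4) - - (1/2))"
      by (simp only: powr_diff) (simp add: \<alpha> \<gamma> N_def)
    then show ?thesis using le_R[of "1/4"] gb by simp
  qed
  have 5: "\<gamma> \<le> \<gamma>bar * R" using le_R[of "3/4"] gb by (simp add: \<gamma> N_def)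
  have "\<gamma> * N * (1 / N * S) = \<gamma> * S" using N by simp
  also have "\<dots> \<le> \<Delta> + 2 * D * \<gamma> * (N * (E * \<alpha> powr ((p - 1) / p) + L * (2 * D * \<gamma>) / \<alpha>) + n / \<alpha>)
        + N * (8 * L * D\<^sup>2 * \<gamma>\<^sup>2)"
    using S by (simp only: N_def)
  also have "\<dots> = \<gamma> * N * (\<Delta> * (1 / (\<gamma> * N)) + 2 * D * (E * \<alpha> powr ((p - 1) / p) + 2 * L * D * (\<gamma> / \<alpha>) + n * (1 / (\<alpha> * N)))
      + 8 * L * D\<^sup>2 * \<gamma>)"
    using N \<gamma>_pos \<alpha>_pos by (simp add: field_simps power2_eq_square)
  finally have "1 / N * S \<le> \<Delta> * (1 / (\<gamma> * N)) + 2 * D * (E * \<alpha> powr ((p - 1) / p) + 2 * L * D * (\<gamma> / \<alpha>) + n * (1 / (\<alpha> * N)))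
      + 8 * L * D\<^sup>2 * \<gamma>"
    using \<gamma>_pos N by (simp only: mult_le_cancel_left_pos mult_pos_pos)
  also have "\<dots> \<le> \<Delta> * (R / \<gamma>bar) + 2 * D * (E * R + 2 * L * D * (\<gamma>bar * R) + n * R) + 8 * L * D\<^sup>2 * (\<gamma>bar * R)"
    using 1 2 3 4 5 nonneg by (intro add_mono mult_left_mono) auto
  also have "\<dots> = (\<Delta> / \<gamma>bar + 2 * D * (E + 2 * L * D * \<gamma>bar + n) + 8 * L * D\<^sup>2 * \<gamma>bar) * R"
    by (simp add: algebra_simps)
  finally show ?thesis by (simp add: R_def N_def)
qed

section \<open>The convergence rate\<close>

theorem theorem4p3:
  fixes f :: "'a::euclidean_space \<Rightarrow> real"
    and g \<phi> :: "'a \<Rightarrow> ereal"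
    and P :: "'s measure"
    and G :: "'a \<Rightarrow> 's \<Rightarrow> 'a"
    and L \<mu> \<sigma> p \<gamma>bar :: real
    and x0 :: 'a
  assumes "C1_on UNIV f" and "L > 0" and "L-lipschitz_on UNIV (grad f)"
    and "proper_fun g" and "lsc_fun g" and "prox_bounded g"
    and "(INF x. ereal (f x) + g x) > -\<infinity>"
    and "reference_function \<mu> \<phi>"
    and "(SUP x\<in>edom \<phi>. ereal (norm x)) < \<infinity>"
    and "\<sigma> \<ge> 0" and "1 < p" and "p \<le> 2"
    and "stochastic_oracle f P G \<sigma> p"
    and "\<gamma>bar > 0" and "x0 \<in> edom g"
  shows "\<exists>C::real. \<forall>K::nat. \<forall>\<alpha> \<gamma>.
    \<alpha> = (real K + 1) powr (- (1/2)) \<longrightarrow>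
    \<gamma> = \<gamma>bar * (real K + 1) powr (- (3/4)) \<longrightarrow>
    prox_threshold g > ereal (\<gamma> / \<mu>) \<longrightarrow>
    (\<forall>(M :: 'w measure) \<xi> x y d v.
       algorithm_run g \<phi> P G \<alpha> \<gamma> x0 M \<xi> x y d v \<longrightarrow>
         (\<forall>k\<le>K. integrable M (\<lambda>w. gap f \<phi> (x (Suc k) w) (v k w))) \<and>
         1 / (real K + 1) * (\<Sum>k=0..K. (\<integral>w. gap f \<phi> (x (Suc k) w) (v k w) \<partial>M))
           \<le> C * (real K + 1) powr (- min (1/4) ((p - 1) / (2 * p))))"
proof -
  obtain D where D: "(SUP x\<in>edom \<phi>. ereal (norm x)) < ereal D"
    using ereal_dense2[OF assms(9)] by blast
  interpret bounded_reference \<phi> \<mu> D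
  proof
    fix x assume "x \<in> edom \<phi>"
    then have "ereal (norm x) \<le> (SUP x\<in>edom \<phi>. ereal (norm x))" by (rule SUP_upper)
    also note D
    finally show "norm x \<le> D" by simp
  qed (rule assms(8))
  obtain m where m: "ereal m < (INF x. ereal (f x) + g x)"
    using ereal_dense2[OF assms(7)] by blast
  have low: "m \<le> f z + real_of_ereal (g z)" if "z \<in> edom g" for z
  proof -
    have "g z = ereal (real_of_ereal (g z))"
      using that assms(4) by (cases "g z") (auto simp: edom_def proper_fun_def)
    moreover have "ereal m \<le> ereal (f z) + g z"
      using m by (rule order_trans[OF less_imp_le INF_lower]) simp
    ultimately show ?thesis by (metis ereal_less_eq(3) plus_ereal.simps(1))
  qed
  let ?C = "(f x0 + real_of_ereal (g x0) - m) / \<gamma>bar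
      + 2 * D * ((1 + 6 * \<sigma> powr p) + 2 * L * D * \<gamma>bar + (1 + \<sigma> powr p)) + 8 * L * D\<^sup>2 * \<gamma>bar"
  show ?thesis
  proof (intro exI[of _ ?C] allI impI)
    fix K :: nat and \<alpha> \<gamma> and M :: "'w measure" and \<xi> x y d v
    assume \<alpha>: "\<alpha> = (real K + 1) powr (- (1/2))" and \<gamma>: "\<gamma> = \<gamma>bar * (real K + 1) powr (- (3/4))"
      and run: "algorithm_run g \<phi> P G \<alpha> \<gamma> x0 M \<xi> x y d v"
    have \<gamma>0: "0 < \<gamma>" using assms(14) by (simp add: \<gamma>)
    have \<alpha>01: "0 < \<alpha>" "\<alpha> \<le> 1"
      using powr_mono[of "- (1/2)" 0 "real K + 1"] by (simp_all add: \<alpha>)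
    note E = expected_gap_sum[OF assms(1,3,4) low assms(15,13,11,12) \<gamma>0 \<alpha>01 run]
    show "(\<forall>k\<le>K. integrable M (\<lambda>w. gap f \<phi> (x (Suc k) w) (v k w))) \<and>
         1 / (real K + 1) * (\<Sum>k=0..K. (\<integral>w. gap f \<phi> (x (Suc k) w) (v k w) \<partial>M))
           \<le> ?C * (real K + 1) powr (- min (1/4) ((p - 1) / (2 * p)))"
      using E(1) rate_arithmetic[OF _ _ _ D_nonneg _ assms(14,11) \<alpha> \<gamma> E(2)]
        low[OF assms(15)] assms(2) by simp
  qed
qed

end
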